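(* Via the homomorphism $\Psi:U_q(\mathfrak{sp}_{2n})\to U_q^{2n}\subseteq\operatorname{End}_{\mathbf{k}}(\mathcal X)$ (so $E_i,F_i,K_i^{\pm1}$ act by $e_i,f_i,k_i^{\pm1}$), the algebra $\mathcal X$ is a left $U_q(\mathfrak{sp}_{2n})$-module algebra, i.e. $h.1=\varepsilon(h)1$ and $h.(uv)=\sum(h_{(1)}.u)(h_{(2)}.v)$ for all $h\in U_q(\mathfrak{sp}_{2n})$, $u,v\in\mathcal X$, where $\Delta(h)=\sum h_{(1)}\otimes h_{(2)}$.
   Context: Let $\mathbf{k}$ be a field of characteristic $0$, $q\in\mathbf{k}$ invertible and not a root of unity, $n\ge 2$, $I=\{-n,\dots,-1,1,\dots,n\}$, $I^+=\{1,\dots,n\}$, $\lambda=q-q^{-1}$, $[m]_q=\frac{q^m-q^{-m}}{q-q^{-1}}$. The quantum symplectic space $\mathcal X$ is the $\mathbf{k}$-algebra generated by $x_i$ ($i\in I$) with relations $x_jx_i=qx_ix_j$ for $i<j$, $j\neq-i$, and $x_ix_{-i}=q^2x_{-i}x_i+q^2\lambda\Omega_{i+1}$ ($i\in I^+$), where $\Omega_i=\sum_{j=i}^nq^{j-i}x_{-j}x_j$, $\Omega_{n+1}=0$. Normal monomials $x^a=x_{-n}^{a_{-n}}\cdots x_{-1}^{a_{-1}}x_1^{a_1}\cdots x_n^{a_n}$ form a basis. Operators: $\partial_i.x^a=[a_i]_qx^{a-\varepsilon_i}$, $x_{i_L}.f=x_if$, $x_{i_R}.f=fx_i$, $\mu_i^{\pm1}.x^a=q^{\pm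 a_i}x^a$; $\tau_i=\prod_{j=i}^n\mu_j$, $\tau_{-i}=\prod_{j=-n}^{-i}\mu_j$ ($i\in I^+$), $\tau_{\pm(n+1)}=1$. $e_1=[2]_q^{-1}q^{-1}\mu_1^{-1}(\tau_{-2}^{-1}x_{-1_L}+q^2\tau_2^{-1}x_{-1_R})\partial_1$, $f_1=[2]_q^{-1}q^{-1}\mu_{-1}^{-1}(\tau_2^{-1}x_{1_R}+q^2\tau_{-2}^{-1}x_{1_L})\partial_{-1}$, $k_1=\mu_{-1}^2\mu_1^{-2}$, and for $2\le i\le n$: $e_i=\mu_{i-1}\mu_i^{-1}\tau_{-i-1}^{-1}x_{-i_L}\partial_{1-i}-\tau_i^{-1}x_{i-1_R}\partial_i$, $f_i=-\mu_{1-i}\mu_{-i}^{-1}\tau_{i+1}^{-1}x_{i_R}\partial_{i-1}+\tau_{-i}^{-1}x_{1-i_L}\partial_{-i}$, $k_i=\mu_{-i}\mu_{1-i}^{-1}\mu_{i-1}\mu_i^{-1}$. $U_q^{2n}$ is the subalgebra of $\operatorname{End}(\mathcal X)$ generated by these; $\Psi$ is the surjective algebra homomorphism $U_q(\mathfrak{sp}_{2n})\to U_q^{2n}$, $E_i\mapsto e_i$, $F_i\mapsto f_i$, $K_i^{\pm1}\mapsto k_i^{\pm1}$ (its existence is part of the paper's results). $U_q(\mathfrak{sp}_{2n})$ is the standard Drinfeld–Jimbo quantum group of type $C_n$ (simple roots $\alpha_1=2\epsilon_1$ long, $\alpha_i=\epsilon_i-\epsilon_{i-1}$, $q_1=q^2$,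 $q_i=q$ for $i>1$), with Hopf structure $\Delta(E_i)=E_i\otimes K_i+1\otimes E_i$, $\Delta(F_i)=F_i\otimes1+K_i^{-1}\otimes F_i$, $\Delta(K_i^{\pm1})=K_i^{\pm1}\otimes K_i^{\pm1}$, $\varepsilon(E_i)=\varepsilon(F_i)=0$, $\varepsilon(K_i^{\pm1})=1$. *)

theory Defs
  imports Main
begin

definition idx :: "nat \<Rightarrow> int list" where
  "idx n = [- int n .. -1] @ [1 .. int n]"

definition Iset :: "nat \<Rightarrow> int set" where
  "Iset n = set (idx n)"

definition admissible :: "nat \<Rightarrow> (int \<Rightarrow> nat) \<Rightarrow> bool" where
  "admissible n a = (\<forall>j. j \<notin> Iset n \<longrightarrow> a j = 0)"

definition mono :: "(int \<Rightarrow> 'x::ring_1) \<Rightarrow> nat \<Rightarrow> (int \<Rightarrow> nat) \<Rightarrow> 'x" where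
  "mono xg n a = prod_list (map (\<lambda>j. xg j ^ a j) (idx n))"

definition is_coeffs :: "nat \<Rightarrow> ((int \<Rightarrow> nat) \<Rightarrow> 'k::zero) \<Rightarrow> bool" where
  "is_coeffs n c = (finite {a. c a \<noteq> 0} \<and> (\<forall>a. c a \<noteq> 0 \<longrightarrow> admissible n a))"

text \<open>The k-linear combination of normal monomials with coefficient function c
  (scalars act via the structure map emb : k \<rightarrow> X).\<close>
definition lincomb :: "('k::zero \<Rightarrow> 'x::ring_1) \<Rightarrow> (int \<Rightarrow> 'x) \<Rightarrow> nat \<Rightarrow> ((int \<Rightarrow> nat) \<Rightarrow> 'k) \<Rightarrow> 'x" where
  "lincomb emb xg n c = (\<Sum>a\<in>{a. c a \<noteq> 0}. emb (c a) * mono xg n a)"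

definition normal_basis :: "('k::zero \<Rightarrow> 'x::ring_1) \<Rightarrow> (int \<Rightarrow> 'x) \<Rightarrow> nat \<Rightarrow> bool" where
  "normal_basis emb xg n = (\<forall>u. \<exists>!c. is_coeffs n c \<and> u = lincomb emb xg n c)"

definition coef :: "('k::zero \<Rightarrow> 'x::ring_1) \<Rightarrow> (int \<Rightarrow> 'x) \<Rightarrow> nat \<Rightarrow> 'x \<Rightarrow> (int \<Rightarrow> nat) \<Rightarrow> 'k" where
  "coef emb xg n u = (THE c. is_coeffs n c \<and> u = lincomb emb xg n c)"

definition linext :: "('k::zero \<Rightarrow> 'x::ring_1) \<Rightarrow> (int \<Rightarrow> 'x) \<Rightarrow> nat \<Rightarrow> ((int \<Rightarrow> nat) \<Rightarrow> 'x) \<Rightarrow> 'x \<Rightarrow> 'x" where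
  "linext emb xg n g u = (\<Sum>a\<in>{a. coef emb xg n u a \<noteq> 0}. emb (coef emb xg n u a) * g a)"

definition k_algebra_map :: "('k::field \<Rightarrow> 'x::ring_1) \<Rightarrow> bool" where
  "k_algebra_map emb = ((\<forall>a b. emb (a + b) = emb a + emb b) \<and> (\<forall>a b. emb (a * b) = emb a * emb b)
      \<and> emb 1 = 1 \<and> (\<forall>c u. emb c * u = u * emb c))"

definition qint :: "'k::field \<Rightarrow> nat \<Rightarrow> 'k" where
  "qint q m = (q ^ m - inverse q ^ m) / (q - inverse q)"

definition Omega :: "('k::field \<Rightarrow> 'x::ring_1) \<Rightarrow> (int \<Rightarrow> 'x) \<Rightarrow> nat \<Rightarrow> 'k \<Rightarrow> int \<Rightarrow> 'x" where
  "Omega emb xg n q i = (\<Sum>j\<in>{i .. int n}. emb (q ^ nat (j - i)) * xg (- j) * xg j)"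

definition quantum_symplectic_space ::
  "('k::field \<Rightarrow> 'x::ring_1) \<Rightarrow> (int \<Rightarrow> 'x) \<Rightarrow> nat \<Rightarrow> 'k \<Rightarrow> bool" where
  "quantum_symplectic_space emb xg n q =
     (k_algebra_map emb
      \<and> (\<forall>i\<in>Iset n. \<forall>j\<in>Iset n. i < j \<and> j \<noteq> - i \<longrightarrow> xg j * xg i = emb q * xg i * xg j)
      \<and> (\<forall>i\<in>{1 .. int n}. xg i * xg (- i) =
            emb (q ^ 2) * xg (- i) * xg i + emb (q ^ 2 * (q - inverse q)) * Omega emb xg n q (i + 1))
      \<and> normal_basis emb xg n)"

definition dop :: "('k::field \<Rightarrow> 'x::ring_1) \<Rightarrow> (int \<Rightarrow> 'x) \<Rightarrow> nat \<Rightarrow> 'k \<Rightarrow> int \<Rightarrow> 'x \<Rightarrow> 'x" where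
  "dop emb xg n q i = linext emb xg n (\<lambda>a. emb (qint q (a i)) * mono xg n (a(i := a i - 1)))"

definition muop :: "('k::field \<Rightarrow> 'x::ring_1) \<Rightarrow> (int \<Rightarrow> 'x) \<Rightarrow> nat \<Rightarrow> 'k \<Rightarrow> int \<Rightarrow> 'x \<Rightarrow> 'x" where
  "muop emb xg n q i = linext emb xg n (\<lambda>a. emb (q ^ a i) * mono xg n a)"

definition muinvop :: "('k::field \<Rightarrow> 'x::ring_1) \<Rightarrow> (int \<Rightarrow> 'x) \<Rightarrow> nat \<Rightarrow> 'k \<Rightarrow> int \<Rightarrow> 'x \<Rightarrow> 'x" where
  "muinvop emb xg n q i = linext emb xg n (\<lambda>a. emb (inverse q ^ a i) * mono xg n a)"

text \<open>tau_i^{-1} = prod_{j=i}^n mu_j^{-1} and tau_{-i}^{-1} = prod_{j=-n}^{-i} mu_j^{-1}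
  for i in {1..n+1} (empty product = identity for i = n+1).\<close>
definition taupinv :: "('k::field \<Rightarrow> 'x::ring_1) \<Rightarrow> (int \<Rightarrow> 'x) \<Rightarrow> nat \<Rightarrow> 'k \<Rightarrow> int \<Rightarrow> 'x \<Rightarrow> 'x" where
  "taupinv emb xg n q i = foldr (\<circ>) (map (muinvop emb xg n q) [i .. int n]) id"

definition tauminv :: "('k::field \<Rightarrow> 'x::ring_1) \<Rightarrow> (int \<Rightarrow> 'x) \<Rightarrow> nat \<Rightarrow> 'k \<Rightarrow> int \<Rightarrow> 'x \<Rightarrow> 'x" where
  "tauminv emb xg n q i = foldr (\<circ>) (map (muinvop emb xg n q) [- int n .. - i]) id"

definition e_op :: "('k::field \<Rightarrow> 'x::ring_1) \<Rightarrow> (int \<Rightarrow> 'x) \<Rightarrow> nat \<Rightarrow> 'k \<Rightarrow> nat \<Rightarrow> 'x \<Rightarrow> 'x" where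
  "e_op emb xg n q i = (let d = dop emb xg n q; mu = muop emb xg n q; mi = muinvop emb xg n q;
       tp = taupinv emb xg n q; tm = tauminv emb xg n q; ii = int i in
     if i = 1 then
       (\<lambda>u. emb (inverse (qint q 2) * inverse q) *
              mi 1 (tm 2 (xg (-1) * d 1 u) + emb (q ^ 2) * tp 2 (d 1 u * xg (-1))))
     else
       (\<lambda>u. mu (ii - 1) (mi ii (tm (ii + 1) (xg (- ii) * d (1 - ii) u)))
             - tp ii (d ii u * xg (ii - 1))))"

definition f_op :: "('k::field \<Rightarrow> 'x::ring_1) \<Rightarrow> (int \<Rightarrow> 'x) \<Rightarrow> nat \<Rightarrow> 'k \<Rightarrow> nat \<Rightarrow> 'x \<Rightarrow> 'x" where
  "f_op emb xg n q i = (let d = dop emb xg n q; mu = muop emb xg n q; mi = muinvop emb xg n q;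
       tp = taupinv emb xg n q; tm = tauminv emb xg n q; ii = int i in
     if i = 1 then
       (\<lambda>u. emb (inverse (qint q 2) * inverse q) *
              mi (-1) (tp 2 (d (-1) u * xg 1) + emb (q ^ 2) * tm 2 (xg 1 * d (-1) u)))
     else
       (\<lambda>u. - mu (1 - ii) (mi (- ii) (tp (ii + 1) (d (ii - 1) u * xg ii)))
             + tm ii (xg (1 - ii) * d (- ii) u)))"

definition k_op :: "('k::field \<Rightarrow> 'x::ring_1) \<Rightarrow> (int \<Rightarrow> 'x) \<Rightarrow> nat \<Rightarrow> 'k \<Rightarrow> nat \<Rightarrow> 'x \<Rightarrow> 'x" where
  "k_op emb xg n q i = (let mu = muop emb xg n q; mi = muinvop emb xg n q; ii = int i in
     if i = 1 then mu (-1) \<circ> mu (-1) \<circ> mi 1 \<circ> mi 1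
     else mu (- ii) \<circ> mi (1 - ii) \<circ> mu (ii - 1) \<circ> mi ii)"

definition kinv_op :: "('k::field \<Rightarrow> 'x::ring_1) \<Rightarrow> (int \<Rightarrow> 'x) \<Rightarrow> nat \<Rightarrow> 'k \<Rightarrow> nat \<Rightarrow> 'x \<Rightarrow> 'x" where
  "kinv_op emb xg n q i = (let mu = muop emb xg n q; mi = muinvop emb xg n q; ii = int i in
     if i = 1 then mi (-1) \<circ> mi (-1) \<circ> mu 1 \<circ> mu 1
     else mi (- ii) \<circ> mu (1 - ii) \<circ> mi (ii - 1) \<circ> mu ii)"

datatype gen = E nat | F nat | K nat | Kinv nat

fun gen_index :: "gen \<Rightarrow> nat" where
  "gen_index (E i) = i" | "gen_index (F i) = i" | "gen_index (K i) = i" | "gen_index (Kinv i) = i"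

text \<open>A word g_1 ... g_m in the generators (the empty word is 1); it acts by Psi(g_1) o ... o Psi(g_m).\<close>
type_synonym word = "gen list"

definition valid_word :: "nat \<Rightarrow> word \<Rightarrow> bool" where
  "valid_word n w = (\<forall>g\<in>set w. 1 \<le> gen_index g \<and> gen_index g \<le> n)"

fun Psi_gen :: "('k::field \<Rightarrow> 'x::ring_1) \<Rightarrow> (int \<Rightarrow> 'x) \<Rightarrow> nat \<Rightarrow> 'k \<Rightarrow> gen \<Rightarrow> 'x \<Rightarrow> 'x" where
  "Psi_gen emb xg n q (E i) = e_op emb xg n q i"
| "Psi_gen emb xg n q (F i) = f_op emb xg n q i"
| "Psi_gen emb xg n q (K i) = k_op emb xg n q i"
| "Psi_gen emb xg n q (Kinv i) = kinv_op emb xg n q i"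

definition Psi_word :: "('k::field \<Rightarrow> 'x::ring_1) \<Rightarrow> (int \<Rightarrow> 'x) \<Rightarrow> nat \<Rightarrow> 'k \<Rightarrow> word \<Rightarrow> 'x \<Rightarrow> 'x" where
  "Psi_word emb xg n q w = foldr (\<circ>) (map (Psi_gen emb xg n q) w) id"

text \<open>Coproduct of a generator as a list of pure tensors a \<otimes> b (all with coefficient 1):
  Delta(E_i) = E_i \<otimes> K_i + 1 \<otimes> E_i, Delta(F_i) = F_i \<otimes> 1 + K_i^{-1} \<otimes> F_i,
  Delta(K_i^{\<plusminus>1}) = K_i^{\<plusminus>1} \<otimes> K_i^{\<plusminus>1}.\<close>
fun cop_gen :: "gen \<Rightarrow> (word \<times> word) list" where
  "cop_gen (E i) = [([E i], [K i]), ([], [E i])]"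
| "cop_gen (F i) = [([F i], []), ([Kinv i], [F i])]"
| "cop_gen (K i) = [([K i], [K i])]"
| "cop_gen (Kinv i) = [([Kinv i], [Kinv i])]"

text \<open>Coproduct of a word, using multiplicativity: (a \<otimes> b)(a' \<otimes> b') = aa' \<otimes> bb'.\<close>
fun cop_word :: "word \<Rightarrow> (word \<times> word) list" where
  "cop_word [] = [([], [])]"
| "cop_word (g # w) = concat (map (\<lambda>(a, b). map (\<lambda>(a', b'). (a @ a', b @ b')) (cop_word w)) (cop_gen g))"

fun eps_gen :: "gen \<Rightarrow> 'k::field" where
  "eps_gen (E i) = 0" | "eps_gen (F i) = 0" | "eps_gen (K i) = 1" | "eps_gen (Kinv i) = 1"

definition eps_word :: "word \<Rightarrow> 'k::field" where
  "eps_word w = prod_list (map eps_gen w)"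

text \<open>An element h of U_q(sp_2n), written as a finite linear combination
  h = \<Sum> c_j w_j of words in the generators (U_q(sp_2n) is spanned by such words).\<close>
type_synonym 'k uelt = "('k \<times> word) list"

definition act :: "('k::field \<Rightarrow> 'x::ring_1) \<Rightarrow> (int \<Rightarrow> 'x) \<Rightarrow> nat \<Rightarrow> 'k \<Rightarrow> 'k uelt \<Rightarrow> 'x \<Rightarrow> 'x" where
  "act emb xg n q h u = sum_list (map (\<lambda>(c, w). emb c * Psi_word emb xg n q w u) h)"

definition eps_u :: "'k::field uelt \<Rightarrow> 'k" where
  "eps_u h = sum_list (map (\<lambda>(c, w). c * eps_word w) h)"

definition act_cop :: "('k::field \<Rightarrow> 'x::ring_1) \<Rightarrow> (int \<Rightarrow> 'x) \<Rightarrow> nat \<Rightarrow> 'k \<Rightarrow> 'k uelt \<Rightarrow> 'x \<Rightarrow> 'x \<Rightarrow> 'x" where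
  "act_cop emb xg n q h u v = sum_list (map (\<lambda>(c, w). emb c *
       sum_list (map (\<lambda>(a, b). Psi_word emb xg n q a u * Psi_word emb xg n q b v) (cop_word w))) h)"

end

(* On normal monomials the operators e_i can be computed explicitly. A linear map on X that is
   prescribed on normal monomials intertwines left multiplication by x_j with operators T_j as soon
   as the T_j satisfy the defining relations and the intertwining holds for products that are already
   normal. Taking values in X x X with T_j (a, b) = (k_i(x_j) a, e_i(x_j) a + x_j b), this turns the
   twisted Leibniz rule for e_i into a finite check on the relations and on the products x_j x^a that
   are normal. The operators f_i are, up to sign, conjugate to the e_i under the anti-automorphism
   x_i -> x_{-i}, and the Leibniz rules extend from generators to words by multiplicativity of the
   coproduct. *)
theory Submission
  imports Complex_Main Defs "HOL-Library.Product_Plus"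
begin

subsection \<open>Scalars, relations and normal monomials\<close>

text \<open>The formulas for \<open>e_i\<close> refer to normal monomials, but a product of two
  normal monomials is normal only after reordering, so the Leibniz rule cannot be read off from
  them. Reordering costs a power of q except at a pair \<open>x_i\<close>, \<open>x_{-i}\<close>,
  which creates the terms of \<open>Omega\<close>. Pairs turn the rule in two arguments into a
  property of one linear map: \<open>T_j\<close> is the triangular matrix with diagonal entries
  \<open>k_i(x_j)\<close>, \<open>x_j\<close> and corner entry \<open>e_i(x_j)\<close>, applied to
  the column with entries \<open>k_i(v)\<close>, \<open>e_i(v)\<close>. The corner of a relation
  between these matrices says that the Leibniz expansion of \<open>e_i\<close> takes the same value
  on both sides of the relation.

  For i >= 2 the inverse tau operators cancel the powers of q caused by inserting a letter, so
  \<open>e_i\<close> of a normal monomial is a combination of at most two others. For the long root,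
  \<open>e_1\<close> also multiplies by \<open>x_{-1}\<close> on the right; this letter crosses the
  powers of \<open>x_1\<close> and leaves terms with \<open>Omega_2\<close>. An anti-automorphism
  swaps the factors of a product, so it exchanges a rule with \<open>k_i\<close> on the right and a
  rule with the inverse of \<open>k_i\<close> on the left.\<close>

definition list_mono :: "(int \<Rightarrow> 'x::ring_1) \<Rightarrow> (int \<Rightarrow> nat) \<Rightarrow> int list \<Rightarrow> 'x" where
  "list_mono xg a L = prod_list (map (\<lambda>j. xg j ^ a j) L)"

locale quantum_symplectic =
  fixes emb :: "'k::field_char_0 \<Rightarrow> 'x::ring_1"
    and xg :: "int \<Rightarrow> 'x" and n :: nat and q :: 'k
  assumes n_ge_2: "n \<ge> 2"
    and q_nonzero [simp]: "q \<noteq> 0"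
    and q_not_root: "\<And>m::nat. m > 0 \<Longrightarrow> q ^ m \<noteq> 1"
    and space: "quantum_symplectic_space emb xg n q"
begin

text \<open>Hiding \<open>emb\<close> behind a scalar action makes X a \<open>module\<close>, so
  that spans and linear maps come from the general theory, which also covers X x X as a
  target.\<close>

definition sc :: "'k \<Rightarrow> 'x \<Rightarrow> 'x" (infixr \<open>\<cdot>\<close> 75) where
  "c \<cdot> u = emb c * u"

lemma emb_add: "emb (a + b) = emb a + emb b"
  and emb_mult: "emb (a * b) = emb a * emb b"
  and emb_1 [simp]: "emb 1 = 1"
  and emb_central: "emb c * u = u * emb c"
  using space unfolding quantum_symplectic_space_def k_algebra_map_def by blast+

sublocale module sc
  by standard (simp_all add: sc_def algebra_simps emb_add emb_mult)

lemma sc_mult_left [simp]: "(c \<cdot> u) * v = c \<cdot> (u * v)"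
  by (simp add: sc_def mult.assoc)

lemma sc_mult_right [simp]: "u * (c \<cdot> v) = c \<cdot> (u * v)"
  by (metis sc_def emb_central mult.assoc)

abbreviation lam :: 'k where "lam \<equiv> q - inverse q"

lemma q_neq_inverse [simp]: "q \<noteq> inverse q"
  using q_not_root[of 2] by (auto simp: power2_eq_square field_simps)

text \<open>The numerator of \<open>[2]_q\<close> vanishes only if \<open>q ^ 4 = 1\<close>; its
  inverse is part of the normalisation of \<open>e_1\<close>.\<close>

lemma qint_2_nonzero [simp]: "qint q 2 \<noteq> 0"
proof -
  have "q ^ 2 * q ^ 2 \<noteq> 1"
    using q_not_root[of 4] by (simp flip: power_add)
  then have "q ^ 2 - inverse q ^ 2 \<noteq> 0"
    by (auto simp: field_simps)
  then show ?thesis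
    by (simp add: qint_def)
qed

lemma qint_0 [simp]: "qint q 0 = 0"
  by (simp add: qint_def)

lemma lambda_qint: "lam * qint q c = q ^ c - inverse q ^ c"
  by (simp add: qint_def)

text \<open>This asymmetric recursion is the Leibniz rule on a power of a letter x:
  \<open>inverse q ^ c\<close> is the eigenvalue of \<open>k_i\<close> on \<open>x ^ c\<close>, and
  q arises when x moves past the letter \<open>e_i(x)\<close>.\<close>

lemma qint_Suc: "qint q (Suc c) = q * qint q c + inverse q ^ c"
proof -
  have "lam * qint q (Suc c) = q * (lam * qint q c) + lam * inverse q ^ c"
    unfolding lambda_qint by (simp add: algebra_simps)
  also have "\<dots> = lam * (q * qint q c + inverse q ^ c)"
    by (simp add: algebra_simps)
  finally show ?thesis
    by simp
qed

definition \<Omega> :: "int \<Rightarrow> 'x" where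
  "\<Omega> i = (\<Sum>j\<in>{i..int n}. q ^ nat (j - i) \<cdot> (xg (- j) * xg j))"

lemma Iset_iff: "j \<in> Iset n \<longleftrightarrow> j \<noteq> 0 \<and> \<bar>j\<bar> \<le> int n"
  by (auto simp: Iset_def idx_def)

lemma Iset_uminus [simp]: "- j \<in> Iset n \<longleftrightarrow> j \<in> Iset n"
  by (simp add: Iset_iff)

lemma finite_Iset [simp]: "finite (Iset n)"
  by (simp add: Iset_def)

lemma relation:
  assumes "i \<in> Iset n" "j \<in> Iset n" "i < j" "j \<noteq> - i"
  shows "xg j * xg i = q \<cdot> (xg i * xg j)"
  using space assms unfolding quantum_symplectic_space_def by (auto simp: sc_def mult.assoc)

lemma relation_opposite:
  assumes "1 \<le> i" "i \<le> int n"
  shows "xg i * xg (- i) = q ^ 2 \<cdot> (xg (- i) * xg i) + (q ^ 2 * lam) \<cdot> \<Omega> (i + 1)"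
proof -
  have "Omega emb xg n q k = \<Omega> k" for k
    by (simp add: Omega_def \<Omega>_def sc_def mult.assoc)
  then show ?thesis
    using space assms unfolding quantum_symplectic_space_def sc_def by (auto simp: mult.assoc)
qed

lemma mono_list_mono: "mono xg n a = list_mono xg a (idx n)"
  by (simp add: mono_def list_mono_def)

lemma sorted_idx: "sorted_wrt (<) (idx n)"
  by (auto simp: idx_def sorted_wrt_append)

lemma set_idx: "set (idx n) = Iset n"
  by (simp add: Iset_def)

lemma list_mono_Nil [simp]: "list_mono xg a [] = 1"
  and list_mono_Cons [simp]: "list_mono xg a (j # L) = xg j ^ a j * list_mono xg a L"
  and list_mono_append: "list_mono xg a (L @ M) = list_mono xg a L * list_mono xg a M"
  by (simp_all add: list_mono_def)

lemma list_mono_cong: "(\<And>j. j \<in> set L \<Longrightarrow> a j = b j) \<Longrightarrow> list_mono xg a L = list_mono xg b L"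
  by (simp add: list_mono_def cong: map_cong)

lemma list_mono_upd_notin [simp]: "j \<notin> set L \<Longrightarrow> list_mono xg (a(j := k)) L = list_mono xg a L"
  by (auto intro: list_mono_cong)

section \<open>Moving a letter into its place in a normal monomial\<close>

lemma q_commute_power_right:
  assumes "u * v = c \<cdot> (v * u)"
  shows "u * v ^ k = c ^ k \<cdot> (v ^ k * u)"
proof (induction k)
  case (Suc k)
  have "u * v ^ Suc k = (u * v) * v ^ k"
    by (simp add: mult.assoc)
  also have "\<dots> = c \<cdot> (v * (u * v ^ k))"
    by (simp add: assms mult.assoc)
  also have "\<dots> = c ^ Suc k \<cdot> (v ^ Suc k * u)"
    by (simp add: Suc mult.assoc)
  finally show ?case .
qed simp

lemma q_commute_power_left:
  assumes "v * u = c \<cdot> (u * v)"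
  shows "v ^ k * u = c ^ k \<cdot> (u * v ^ k)"
proof (induction k)
  case (Suc k)
  have "v ^ Suc k * u = v * (v ^ k * u)"
    by (simp add: mult.assoc)
  also have "\<dots> = c ^ k \<cdot> ((v * u) * v ^ k)"
    by (simp add: Suc mult.assoc)
  also have "\<dots> = c ^ Suc k \<cdot> (u * v ^ Suc k)"
    by (simp add: assms mult.assoc mult.commute)
  finally show ?case .
qed simp

text \<open>Only letters smaller than j are crossed, and each adds its exponent to the power of q.
  The last assumption excludes \<open>x_{-j}\<close>, whose exchange with \<open>x_j\<close> is not
  a mere q-commutation. General increasing lists serve the induction and later the parts of a
  monomial on one side of 0.\<close>

lemma list_mono_insert_left:
  assumes "sorted_wrt (<) L" "j \<in> set L" "set L \<subseteq> Iset n"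
    and "\<And>m. m \<in> set L \<Longrightarrow> m < j \<Longrightarrow> m = - j \<Longrightarrow> a m = 0"
  shows "xg j * list_mono xg a L = q ^ (\<Sum>m | m \<in> set L \<and> m < j. a m) \<cdot> list_mono xg (a(j := Suc (a j))) L"
  using assms
proof (induction L)
  case (Cons m L)
  show ?case
  proof (cases "m = j")
    case True
    then have "j \<notin> set L" and s: "{i. i \<in> set (m # L) \<and> i < j} = {}"
      using Cons.prems by auto
    then have "list_mono xg (a(j := Suc (a j))) L = list_mono xg a L"
      by (rule_tac list_mono_upd_notin)
    then show ?thesis
      unfolding True s[unfolded True] by (simp only: list_mono_Cons fun_upd_same) (simp add: mult.assoc)
  next
    case False
    with Cons.prems have j: "j \<in> set L" "m < j"
      by auto
    have "{i. i \<in> set (m # L) \<and> i < j} = insert m {i. i \<in> set L \<and> i < j}"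
      using j by auto
    moreover have "m \<notin> {i. i \<in> set L \<and> i < j}"
      using Cons.prems by auto
    ultimately have s: "(\<Sum>i | i \<in> set (m # L) \<and> i < j. a i) = a m + (\<Sum>i | i \<in> set L \<and> i < j. a i)"
      by simp
    have "xg j * xg m ^ a m = q ^ a m \<cdot> (xg m ^ a m * xg j)"
    proof (cases "m = - j")
      case True
      then show ?thesis
        using Cons.prems(4)[of m] j by simp
    next
      case False
      then show ?thesis
        using Cons.prems j by (intro q_commute_power_right relation) auto
    qed
    then have "xg j * list_mono xg a (m # L) = q ^ a m \<cdot> (xg m ^ a m * (xg j * list_mono xg a L))"
      by (simp flip: mult.assoc)
    also have "xg j * list_mono xg a L = q ^ (\<Sum>i | i \<in> set L \<and> i < j. a i) \<cdot> list_mono xg (a(j := Suc (a j))) L"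
      using Cons.prems j by (intro Cons.IH) auto
    finally show ?thesis
      using False unfolding s by (simp only: list_mono_Cons fun_upd_other) (simp add: power_add)
  qed
qed simp

lemma list_mono_insert_right:
  assumes "sorted_wrt (<) L" "j \<in> set L" "set L \<subseteq> Iset n"
    and "\<And>m. m \<in> set L \<Longrightarrow> j < m \<Longrightarrow> m = - j \<Longrightarrow> a m = 0"
  shows "list_mono xg a L * xg j = q ^ (\<Sum>m | m \<in> set L \<and> j < m. a m) \<cdot> list_mono xg (a(j := Suc (a j))) L"
  using assms
proof (induction L rule: rev_induct)
  case (snoc m L)
  show ?case
  proof (cases "m = j")
    case True
    then have "j \<notin> set L" and s: "{i. i \<in> set (L @ [m]) \<and> j < i} = {}"
      using snoc.prems by (auto simp: sorted_wrt_append)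
    then have "list_mono xg (a(j := Suc (a j))) L = list_mono xg a L"
      by (rule_tac list_mono_upd_notin)
    then show ?thesis
      unfolding True s[unfolded True] by (simp only: list_mono_append list_mono_Cons list_mono_Nil fun_upd_same) (simp add: mult.assoc power_Suc2 del: power_Suc)
  next
    case False
    with snoc.prems have j: "j \<in> set L" "j < m"
      by (auto simp: sorted_wrt_append)
    have "{i. i \<in> set (L @ [m]) \<and> j < i} = insert m {i. i \<in> set L \<and> j < i}"
      using j by auto
    moreover have "m \<notin> {i. i \<in> set L \<and> j < i}"
      using snoc.prems by (auto simp: sorted_wrt_append)
    ultimately have s: "(\<Sum>i | i \<in> set (L @ [m]) \<and> j < i. a i) = a m + (\<Sum>i | i \<in> set L \<and> j < i. a i)"
      by simp
    have "xg m ^ a m * xg j = q ^ a m \<cdot> (xg j * xg m ^ a m)"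
    proof (cases "m = - j")
      case True
      then show ?thesis
        using snoc.prems(4)[of m] j by simp
    next
      case False
      then show ?thesis
        using snoc.prems j by (intro q_commute_power_left relation) auto
    qed
    then have "list_mono xg a (L @ [m]) * xg j = q ^ a m \<cdot> ((list_mono xg a L * xg j) * xg m ^ a m)"
      by (simp add: mult.assoc list_mono_append)
    also have "list_mono xg a L * xg j = q ^ (\<Sum>i | i \<in> set L \<and> j < i. a i) \<cdot> list_mono xg (a(j := Suc (a j))) L"
      using snoc.prems j by (intro snoc.IH) (auto simp: sorted_wrt_append)
    finally show ?thesis
      using False unfolding s by (simp only: list_mono_append list_mono_Cons list_mono_Nil fun_upd_other) (simp add: power_add)
  qed
qed simp

lemmas mono_insert_left = list_mono_insert_left[OF sorted_idx, folded mono_list_mono, unfolded set_idx, OF _ subset_refl]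
lemmas mono_insert_right = list_mono_insert_right[OF sorted_idx, folded mono_list_mono, unfolded set_idx, OF _ subset_refl]

section \<open>Coefficients and linear extension in the basis of normal monomials\<close>

lemma lincomb_sc: "lincomb emb xg n c = (\<Sum>a\<in>{a. c a \<noteq> 0}. c a \<cdot> mono xg n a)"
  by (simp add: lincomb_def sc_def)

lemma normal_basis: "\<exists>!c. is_coeffs n c \<and> u = lincomb emb xg n c"
  using space unfolding quantum_symplectic_space_def normal_basis_def by simp

lemma coef_eqI: "is_coeffs n c \<Longrightarrow> u = lincomb emb xg n c \<Longrightarrow> coef emb xg n u = c"
  unfolding coef_def using normal_basis by (rule the1_equality) simp

lemma coef_props:
  shows is_coeffs_coef: "is_coeffs n (coef emb xg n u)"
    and lincomb_coef: "lincomb emb xg n (coef emb xg n u) = u"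
proof -
  obtain c where "is_coeffs n c" "u = lincomb emb xg n c"
    using normal_basis[of u] by auto
  moreover from this have "coef emb xg n u = c"
    by (rule coef_eqI)
  ultimately show "is_coeffs n (coef emb xg n u)" "lincomb emb xg n (coef emb xg n u) = u"
    by simp_all
qed

lemma sum_support:
  assumes "finite A" "\<And>a. c a \<noteq> 0 \<Longrightarrow> a \<in> A"
  shows "(\<Sum>a\<in>{a. c a \<noteq> 0}. c a \<cdot> g a) = (\<Sum>a\<in>A. c a \<cdot> g a)"
  using assms by (intro sum.mono_neutral_left) auto

text \<open>Cancellation can shrink the support of the sum, so all three sums are extended to the
  union of the two supports.\<close>

lemma sum_support_add:
  assumes "is_coeffs n c" "is_coeffs n d"
  shows "(\<Sum>a | c a + d a \<noteq> 0. (c a + d a) \<cdot> g a) = (\<Sum>a | c a \<noteq> 0. c a \<cdot> g a) + (\<Sum>a | d a \<noteq> 0. d a \<cdot> g a)"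
proof -
  define A where "A = {a. c a \<noteq> 0} \<union> {a. d a \<noteq> 0}"
  have A: "finite A"
    using assms by (simp add: A_def is_coeffs_def)
  have "(\<Sum>a | c a + d a \<noteq> 0. (c a + d a) \<cdot> g a) = (\<Sum>a\<in>A. (c a + d a) \<cdot> g a)"
    using A by (rule sum_support) (auto simp: A_def)
  also have "\<dots> = (\<Sum>a\<in>A. c a \<cdot> g a) + (\<Sum>a\<in>A. d a \<cdot> g a)"
    by (simp add: scale_left_distrib sum.distrib)
  also have "(\<Sum>a\<in>A. c a \<cdot> g a) = (\<Sum>a | c a \<noteq> 0. c a \<cdot> g a)"
    using A by (rule sum_support[symmetric]) (auto simp: A_def)
  also have "(\<Sum>a\<in>A. d a \<cdot> g a) = (\<Sum>a | d a \<noteq> 0. d a \<cdot> g a)"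
    using A by (rule sum_support[symmetric]) (auto simp: A_def)
  finally show ?thesis .
qed

lemma sum_support_scale:
  assumes "is_coeffs n c"
  shows "(\<Sum>a | r * c a \<noteq> 0. (r * c a) \<cdot> g a) = r \<cdot> (\<Sum>a | c a \<noteq> 0. c a \<cdot> g a)"
proof -
  have "(\<Sum>a | r * c a \<noteq> 0. (r * c a) \<cdot> g a) = (\<Sum>a | c a \<noteq> 0. (r * c a) \<cdot> g a)"
    using assms by (intro sum_support) (auto simp: is_coeffs_def)
  then show ?thesis
    by (simp add: scale_sum_right)
qed

lemma linext_sc: "linext emb xg n g u = (\<Sum>a\<in>{a. coef emb xg n u a \<noteq> 0}. coef emb xg n u a \<cdot> g a)"
  by (simp add: linext_def sc_def)

text \<open>Linearity of \<open>coef\<close> comes from uniqueness: the sum of the coefficient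
  functions of u and v represents \<open>u + v\<close>, hence is its coefficient function, and
  likewise for multiples.\<close>

lemma linext_hom: "module_hom sc sc (linext emb xg n g)"
proof (intro module_hom.intro module_axioms module_hom_axioms.intro)
  fix u v r
  let ?c = "coef emb xg n"
  note c = is_coeffs_coef[of u] is_coeffs_coef[of v]
  have "finite {a. ?c u a + ?c v a \<noteq> 0}"
    by (rule finite_subset[of _ "{a. ?c u a \<noteq> 0} \<union> {a. ?c v a \<noteq> 0}"]) (use c in \<open>auto simp: is_coeffs_def\<close>)
  moreover have "admissible n a" if "?c u a + ?c v a \<noteq> 0" for a
  proof -
    have "?c u a \<noteq> 0 \<or> ?c v a \<noteq> 0"
      using that by auto
    then show ?thesis
      using c by (auto simp: is_coeffs_def)
  qed
  moreover have "u + v = lincomb emb xg n (\<lambda>a. ?c u a + ?c v a)"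
    by (simp only: lincomb_sc sum_support_add[OF c] lincomb_coef[unfolded lincomb_sc])
  ultimately have "?c (u + v) = (\<lambda>a. ?c u a + ?c v a)"
    by (intro coef_eqI) (simp_all add: is_coeffs_def)
  then show "linext emb xg n g (u + v) = linext emb xg n g u + linext emb xg n g v"
    by (simp only: linext_sc sum_support_add[OF c])
  have "finite {a. r * ?c u a \<noteq> 0}"
    by (rule finite_subset[of _ "{a. ?c u a \<noteq> 0}"]) (use c in \<open>auto simp: is_coeffs_def\<close>)
  moreover have "r \<cdot> u = lincomb emb xg n (\<lambda>a. r * ?c u a)"
    by (simp only: lincomb_sc sum_support_scale[OF c(1)] lincomb_coef[unfolded lincomb_sc])
  ultimately have "?c (r \<cdot> u) = (\<lambda>a. r * ?c u a)"
    using c(1) by (intro coef_eqI) (simp_all add: is_coeffs_def)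
  then show "linext emb xg n g (r \<cdot> u) = r \<cdot> linext emb xg n g u"
    by (simp only: linext_sc sum_support_scale[OF c(1)])
qed

lemma linext_mono [simp]:
  assumes "admissible n a"
  shows "linext emb xg n g (mono xg n a) = g a"
proof -
  define c :: "(int \<Rightarrow> nat) \<Rightarrow> 'k" where "c = (\<lambda>b. if b = a then 1 else 0)"
  have c: "{b. c b \<noteq> 0} = {a}" "c a = 1"
    by (auto simp: c_def)
  have "is_coeffs n c"
    unfolding is_coeffs_def c(1) using assms by (auto simp: c_def)
  moreover have "mono xg n a = lincomb emb xg n c"
    unfolding lincomb_sc c(1) by (simp add: c(2))
  ultimately have "coef emb xg n (mono xg n a) = c"
    by (rule coef_eqI)
  then show ?thesis
    unfolding linext_sc by (simp only: c) (simp add: c(2))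
qed

definition normal_monos :: "'x set" where
  "normal_monos = mono xg n ` {a. admissible n a}"

lemma span_normal_monos: "span normal_monos = UNIV"
proof -
  have "u \<in> span normal_monos" for u
  proof -
    have "mono xg n a \<in> span normal_monos" if "coef emb xg n u a \<noteq> 0" for a
      using that is_coeffs_coef[of u] unfolding normal_monos_def is_coeffs_def by (blast intro: span_base)
    then have "lincomb emb xg n (coef emb xg n u) \<in> span normal_monos"
      unfolding lincomb_sc by (blast intro: span_sum span_scale)
    then show ?thesis
      unfolding lincomb_coef .
  qed
  then show ?thesis by auto
qed

lemma module_hom_eqI:
  assumes "module_hom sc s f" "module_hom sc s g"
    and "\<And>a. admissible n a \<Longrightarrow> f (mono xg n a) = g (mono xg n a)"
  shows "f u = g u"
proof -
  interpret f: module_hom sc s f by fact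
  interpret g: module_hom sc s g by fact
  have "subspace {u. f u = g u}"
    unfolding subspace_def mem_Collect_eq f.add g.add f.scale g.scale by simp
  moreover have "normal_monos \<subseteq> {u. f u = g u}"
    unfolding normal_monos_def using assms(3) by blast
  ultimately have "span normal_monos \<subseteq> {u. f u = g u}"
    by (intro span_minimal)
  then show ?thesis
    unfolding span_normal_monos by blast
qed

subsection \<open>Operators satisfying the defining relations\<close>

definition deg :: "(int \<Rightarrow> nat) \<Rightarrow> nat" where
  "deg a = (\<Sum>j\<in>Iset n. a j)"

text \<open>The component of degree d. That left multiplication by a letter raises the degree by
  exactly one is proved only inside \<open>intertwine_left_mult\<close>, together with the
  intertwining.\<close>

definition homog :: "nat \<Rightarrow> 'x set" where
  "homog d = span (mono xg n ` {a. admissible n a \<and> deg a = d})"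

lemma admissible_upd [simp]: "admissible n a \<Longrightarrow> j \<in> Iset n \<Longrightarrow> admissible n (a(j := k))"
  by (auto simp: admissible_def)

lemma deg_upd: "j \<in> Iset n \<Longrightarrow> deg (a(j := Suc (a j))) = Suc (deg a)"
  unfolding deg_def by (simp add: sum.remove[of _ j])

lemma mono_prepend:
  assumes "j \<in> Iset n" "\<And>m. m \<in> Iset n \<Longrightarrow> m < j \<Longrightarrow> a m = 0"
  shows "xg j * mono xg n a = mono xg n (a(j := Suc (a j)))"
proof -
  have "(\<Sum>m | m \<in> Iset n \<and> m < j. a m) = 0"
    using assms by (intro sum.neutral) auto
  then show ?thesis
    using assms mono_insert_left[of j a] by simp
qed

text \<open>The letter split off is the smallest one that occurs. If \<open>x_j\<close> cannot
  simply be prepended, some i below j occurs, and the bound by i puts the split letter below j as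
  well.\<close>

lemma mono_decompose:
  assumes "admissible n a" "i \<in> Iset n" "a i \<noteq> 0"
  obtains m b where "m \<in> Iset n" "m \<le> i" "admissible n b" "deg a = Suc (deg b)"
    "mono xg n a = xg m * mono xg n b"
proof -
  define M where "M = {m \<in> Iset n. a m \<noteq> 0}"
  have M: "finite M" "i \<in> M"
    using assms by (simp_all add: M_def)
  then have m: "Min M \<in> M" "Min M \<le> i" "\<And>k. k \<in> M \<Longrightarrow> Min M \<le> k"
    using Min_in by auto
  define m where "m = Min M"
  define b where "b = a(m := a m - 1)"
  have a: "a = b(m := Suc (b m))"
    using m(1) by (auto simp: b_def m_def M_def)
  show ?thesis
  proof (rule that[of m b])
    show mI: "m \<in> Iset n" "m \<le> i"
      using m by (auto simp: m_def M_def)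
    then show "admissible n b"
      using assms by (simp add: b_def)
    show "deg a = Suc (deg b)"
      by (subst a) (use mI in \<open>simp add: deg_upd\<close>)
    have "b k = 0" if "k \<in> Iset n" "k < m" for k
    proof -
      have "k \<notin> M"
        using m(3)[of k] that by (auto simp: m_def)
      then show ?thesis
        using that by (simp add: b_def M_def)
    qed
    then show "mono xg n a = xg m * mono xg n b"
      by (subst a, subst mono_prepend) (use mI in auto)
  qed
qed

text \<open>Moving a letter through a monomial keeps the degree and only creates products whose first
  letter is smaller than the one being moved, so the double induction on the degree and on the
  letter terminates.\<close>

lemma intertwine_left_mult:
  fixes s :: "'k \<Rightarrow> 'm::ab_group_add \<Rightarrow> 'm"
  assumes \<phi>: "module_hom sc s \<phi>" and T: "\<And>j. module_hom s s (T j)"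
    and R1: "\<And>i j m. \<lbrakk>i \<in> Iset n; j \<in> Iset n; i < j; j \<noteq> - i\<rbrakk> \<Longrightarrow> T j (T i m) = s q (T i (T j m))"
    and R2: "\<And>i m. \<lbrakk>1 \<le> i; i \<le> int n\<rbrakk> \<Longrightarrow> T i (T (- i) m) = s (q ^ 2) (T (- i) (T i m)) +
               s (q ^ 2 * lam) (\<Sum>j\<in>{i + 1..int n}. s (q ^ nat (j - (i + 1))) (T (- j) (T j m)))"
    and normal: "\<And>a j. \<lbrakk>admissible n a; j \<in> Iset n; \<And>m. m \<in> Iset n \<Longrightarrow> m < j \<Longrightarrow> a m = 0\<rbrakk> \<Longrightarrow>
               \<phi> (mono xg n (a(j := Suc (a j)))) = T j (\<phi> (mono xg n a))"
    and j: "j \<in> Iset n"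
  shows "\<phi> (xg j * v) = T j (\<phi> v)"
proof -
  interpret \<phi>: module_hom sc s \<phi> by fact
  note T_add = module_hom.add[OF T] and T_scale = module_hom.scale[OF T]
  have T_zero: "T i 0 = 0" for i
    using module_hom.zero[OF T] .
  \<comment> \<open>The claim concerns the whole component and includes membership in
    \<open>homog (Suc d)\<close>, because the hypothesis for smaller letters will be applied to
    products \<open>x_l w\<close>, which need not be normal monomials.\<close>
  define P where "P d j \<longleftrightarrow> (\<forall>v\<in>homog d. xg j * v \<in> homog (Suc d) \<and> \<phi> (xg j * v) = T j (\<phi> v))" for d j
  have P: "P d j" if "j \<in> Iset n" for d j
    using that
  proof (induction d arbitrary: j rule: less_induct)
    case (less d)
    note outer = less.IH
    from less.prems show ?case
    \<comment> \<open>Letters start at -n, so this is the rank of j as a natural number.\<close>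
    proof (induction "nat (j + int n)" arbitrary: j rule: less_induct)
      case less
      have inner: "P d i" if "i \<in> Iset n" "i < j" for i
        using that less by (auto simp: Iset_iff)
      have generators: "xg j * mono xg n a \<in> homog (Suc d) \<and> \<phi> (xg j * mono xg n a) = T j (\<phi> (mono xg n a))"
        if a: "admissible n a" "deg a = d" for a
      proof (cases "\<forall>m\<in>Iset n. m < j \<longrightarrow> a m = 0")
        case True
        then have "mono xg n (a(j := Suc (a j))) \<in> homog (Suc d)"
          unfolding homog_def using less.prems a by (intro span_base) (auto simp: deg_upd simp del: fun_upd_apply)
        moreover have "\<phi> (mono xg n (a(j := Suc (a j)))) = T j (\<phi> (mono xg n a))"
          using True less.prems a by (intro normal) auto
        moreover have "xg j * mono xg n a = mono xg n (a(j := Suc (a j)))"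
          using True less.prems by (intro mono_prepend) auto
        ultimately show ?thesis
          by simp
      next
        case False
        then obtain i where "i \<in> Iset n" "a i \<noteq> 0" "i < j"
          by auto
        then obtain m b where m: "m \<in> Iset n" "m < j" and b: "admissible n b" "deg a = Suc (deg b)"
          and ab: "mono xg n a = xg m * mono xg n b"
          using mono_decompose[of a i] a by (metis le_less_trans)
        define w where "w = mono xg n b"
        have w: "w \<in> homog (deg b)"
          unfolding w_def homog_def using b by (intro span_base) auto
        have d: "deg b < d" "Suc (deg b) = d"
          using a b by auto
        have step: "xg l * w \<in> homog d" "\<phi> (xg l * w) = T l (\<phi> w)" if "l \<in> Iset n" for l
          using outer[OF d(1) that] w d(2) by (auto simp: P_def)
        \<comment> \<open>The product \<open>x_l w\<close> has degree d again, so here the inner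
          hypothesis is used: same degree, smaller letter i.\<close>
        have step2: "xg i * (xg l * w) \<in> homog (Suc d)" "\<phi> (xg i * (xg l * w)) = T i (T l (\<phi> w))"
          if "l \<in> Iset n" "i \<in> Iset n" "i < j" for i l
          using inner[of i] step[of l] that by (auto simp: P_def)
        show ?thesis
        proof (cases "j = - m")
          case False
          have "xg j * mono xg n a = q \<cdot> (xg m * (xg j * w))"
            unfolding ab w_def[symmetric] mult.assoc[symmetric] relation[OF m(1) less.prems m(2) False] by simp
          then show ?thesis
            using step2[of j m] step[of m] m less.prems R1[OF m(1) less.prems m(2) False]
            unfolding ab w_def[symmetric] by (simp add: \<phi>.scale homog_def span_scale)
        next
          case True
          then have j: "1 \<le> j" "j \<le> int n" "m = - j"
            using m less.prems by (auto simp: Iset_iff)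
          \<comment> \<open>Every product in the \<open>Omega\<close> sum begins with
            \<open>x_{-l}\<close>, and \<open>-l < -j < j\<close>.\<close>
          have l: "l \<in> Iset n \<and> - l \<in> Iset n \<and> - l < j" if "l \<in> {j + 1..int n}" for l
            using that j by (auto simp: Iset_iff)
          have "xg j * mono xg n a = q ^ 2 \<cdot> (xg m * (xg j * w)) +
              (q ^ 2 * lam) \<cdot> (\<Sum>l\<in>{j + 1..int n}. q ^ nat (l - (j + 1)) \<cdot> (xg (- l) * (xg l * w)))"
            unfolding ab w_def[symmetric] mult.assoc[symmetric] j(3) relation_opposite[OF j(1,2)] \<Omega>_def
            by (simp add: algebra_simps sum_distrib_right)
          moreover have "\<phi> (\<Sum>l\<in>{j + 1..int n}. q ^ nat (l - (j + 1)) \<cdot> (xg (- l) * (xg l * w))) =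
              (\<Sum>l\<in>{j + 1..int n}. s (q ^ nat (l - (j + 1))) (T (- l) (T l (\<phi> w))))"
            unfolding \<phi>.sum \<phi>.scale using l step2(2) by (intro sum.cong refl) auto
          moreover have "(\<Sum>l\<in>{j + 1..int n}. q ^ nat (l - (j + 1)) \<cdot> (xg (- l) * (xg l * w))) \<in> homog (Suc d)"
            unfolding homog_def using l step2(1)[unfolded homog_def] by (intro span_sum span_scale) auto
          moreover have "xg m * (xg j * w) \<in> homog (Suc d)" "\<phi> (xg m * (xg j * w)) = T m (T j (\<phi> w))"
            using step2[of j m] m less.prems by auto
          moreover have "\<phi> (mono xg n a) = T m (\<phi> w)"
            unfolding ab w_def[symmetric] using step(2)[OF m(1)] .
          ultimately show ?thesis
            using R2[OF j(1,2), of "\<phi> w"] j(3)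
            unfolding homog_def by (simp only: \<phi>.add \<phi>.scale span_add span_scale)
        qed
      qed
      have "subspace {v. xg j * v \<in> homog (Suc d) \<and> \<phi> (xg j * v) = T j (\<phi> v)}"
        unfolding subspace_def mem_Collect_eq distrib_left sc_mult_right \<phi>.add \<phi>.scale T_add T_scale
        by (auto simp: homog_def span_zero span_add span_scale T_zero)
      then have "homog d \<subseteq> {v. xg j * v \<in> homog (Suc d) \<and> \<phi> (xg j * v) = T j (\<phi> v)}"
        using generators by (subst homog_def, intro span_minimal) auto
      then show ?case
        by (auto simp: P_def)
    qed
  qed
  have "module_hom sc s (\<lambda>v. \<phi> (xg j * v))" "module_hom sc s (\<lambda>v. T j (\<phi> v))"
    using T[of j] \<phi> by (auto simp: module_hom_iff distrib_left)
  then show ?thesis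
  proof (rule module_hom_eqI)
    fix a assume "admissible n a"
    then have "mono xg n a \<in> homog (deg a)"
      unfolding homog_def by (intro span_base) auto
    then show "\<phi> (xg j * mono xg n a) = T j (\<phi> (mono xg n a))"
      using P[OF j] by (auto simp: P_def)
  qed
qed

lemma span_induct_generators [consumes 0, case_names one add scale gen]:
  assumes one: "P 1" and add: "\<And>u v. P u \<Longrightarrow> P v \<Longrightarrow> P (u + v)" and scale: "\<And>c u. P u \<Longrightarrow> P (c \<cdot> u)"
    and gen: "\<And>j u. j \<in> Iset n \<Longrightarrow> P u \<Longrightarrow> P (xg j * u)"
  shows "P u"
proof -
  have power: "P (xg j ^ k * w)" if "j \<in> Iset n" "P w" for j k w
    using that by (induction k) (simp_all add: mult.assoc gen)
  have "P (list_mono xg a L)" if "set L \<subseteq> Iset n" for a L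
    using that by (induction L) (simp_all add: one power)
  then have "P (mono xg n a)" for a
    by (simp add: mono_list_mono set_idx)
  then have "normal_monos \<subseteq> {u. P u}"
    by (auto simp: normal_monos_def)
  moreover have "subspace {u. P u}"
    using scale[of _ 0] scale[OF one, of 0] by (auto simp: subspace_def add scale)
  ultimately have "span normal_monos \<subseteq> {u. P u}"
    by (rule span_minimal)
  then show ?thesis
    unfolding span_normal_monos by blast
qed

subsection \<open>Diagonal automorphisms and the reversing anti-automorphism\<close>

lemma relation_assoc:
  assumes "i \<in> Iset n" "j \<in> Iset n" "i < j" "j \<noteq> - i"
  shows "xg j * (xg i * u) = q \<cdot> (xg i * (xg j * u))"
  unfolding mult.assoc[symmetric] relation[OF assms] by simp

lemma relation_opposite_assoc:
  assumes "1 \<le> i" "i \<le> int n"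
  shows "xg i * (xg (- i) * u) = q ^ 2 \<cdot> (xg (- i) * (xg i * u)) +
    (q ^ 2 * lam) \<cdot> (\<Sum>j\<in>{i + 1..int n}. q ^ nat (j - (i + 1)) \<cdot> (xg (- j) * (xg j * u)))"
  unfolding mult.assoc[symmetric] relation_opposite[OF assms] \<Omega>_def
  by (simp add: distrib_right sum_distrib_right mult.assoc)

lemma mono_zero [simp]: "mono xg n (\<lambda>_. 0) = 1"
  by (simp add: mono_def map_replicate_const)

lemma admissible_zero [simp]: "admissible n (\<lambda>_. 0)"
  by (simp add: admissible_def)

lemma mono_single: "j \<in> Iset n \<Longrightarrow> mono xg n ((\<lambda>_. 0)(j := Suc 0)) = xg j"
  using mono_prepend[of j "\<lambda>_. 0"] by simp

section \<open>Linearity of the basic operators and their values on normal monomials\<close>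

abbreviation der where "der \<equiv> dop emb xg n q"
abbreviation \<mu> where "\<mu> \<equiv> muop emb xg n q"
abbreviation \<mu>' where "\<mu>' \<equiv> muinvop emb xg n q"
abbreviation \<tau>p where "\<tau>p \<equiv> taupinv emb xg n q"
abbreviation \<tau>m where "\<tau>m \<equiv> tauminv emb xg n q"
abbreviation eop where "eop \<equiv> e_op emb xg n q"
abbreviation fop where "fop \<equiv> f_op emb xg n q"
abbreviation kop where "kop \<equiv> k_op emb xg n q"
abbreviation kinv where "kinv \<equiv> kinv_op emb xg n q"

lemma der_hom: "module_hom sc sc (der i)"
  and \<mu>_hom: "module_hom sc sc (\<mu> i)"
  and \<mu>'_hom: "module_hom sc sc (\<mu>' i)"
  by (simp_all add: dop_def muop_def muinvop_def linext_hom)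

lemma foldr_\<mu>'_hom: "module_hom sc sc (foldr (\<circ>) (map \<mu>' L) id)"
proof (induction L)
  case (Cons i L)
  have "foldr (\<circ>) (map \<mu>' (i # L)) id = \<mu>' i \<circ> foldr (\<circ>) (map \<mu>' L) id"
    by simp
  then show ?case
    using module_hom_compose[OF Cons \<mu>'_hom] by presburger
qed (simp add: module_hom_iff module_axioms)

lemma \<tau>p_hom: "module_hom sc sc (\<tau>p i)"
  and \<tau>m_hom: "module_hom sc sc (\<tau>m i)"
  by (simp_all only: taupinv_def tauminv_def foldr_\<mu>'_hom)

lemmas operator_add [simp] = der_hom[THEN module_hom.add] \<mu>_hom[THEN module_hom.add]
    \<mu>'_hom[THEN module_hom.add] \<tau>p_hom[THEN module_hom.add] \<tau>m_hom[THEN module_hom.add]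
  and operator_scale [simp] = der_hom[THEN module_hom.scale] \<mu>_hom[THEN module_hom.scale]
    \<mu>'_hom[THEN module_hom.scale] \<tau>p_hom[THEN module_hom.scale] \<tau>m_hom[THEN module_hom.scale]

context
  fixes a assumes a: "admissible n a"
begin

lemma der_mono [simp]: "der i (mono xg n a) = qint q (a i) \<cdot> mono xg n (a(i := a i - 1))"
  and \<mu>_mono [simp]: "\<mu> i (mono xg n a) = q ^ a i \<cdot> mono xg n a"
  and \<mu>'_mono [simp]: "\<mu>' i (mono xg n a) = inverse q ^ a i \<cdot> mono xg n a"
  using a by (simp_all add: dop_def muop_def muinvop_def sc_def)

lemma foldr_\<mu>'_mono: "foldr (\<circ>) (map \<mu>' L) id (mono xg n a) = inverse q ^ sum_list (map a L) \<cdot> mono xg n a"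
  by (induction L) (simp_all add: power_add mult.commute)

lemma \<tau>p_mono [simp]: "\<tau>p i (mono xg n a) = inverse q ^ (\<Sum>j\<in>{i..int n}. a j) \<cdot> mono xg n a"
  by (simp add: taupinv_def foldr_\<mu>'_mono sum_list_distinct_conv_sum_set)

lemma \<tau>m_mono [simp]: "\<tau>m i (mono xg n a) = inverse q ^ (\<Sum>j\<in>{- int n..- i}. a j) \<cdot> mono xg n a"
  by (simp add: tauminv_def foldr_\<mu>'_mono sum_list_distinct_conv_sum_set)

end

text \<open>The letters may be rescaled by w without violating the relations: opposite letters have
  inverse weights, so every term of the relation for \<open>x_i\<close> and \<open>x_{-i}\<close>,
  including those of \<open>Omega\<close>, has weight 1.\<close>

lemma diagonal_hom_mult:
  assumes D: "module_hom sc sc D"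
    and mono: "\<And>a. admissible n a \<Longrightarrow> D (mono xg n a) = \<chi> a \<cdot> mono xg n a"
    and \<chi>_zero: "\<chi> (\<lambda>_. 0) = 1" and \<chi>_Suc: "\<And>a j. j \<in> Iset n \<Longrightarrow> \<chi> (a(j := Suc (a j))) = w j * \<chi> a"
    and w: "\<And>j. j \<in> Iset n \<Longrightarrow> w j * w (- j) = 1"
  shows "D 1 = 1" "j \<in> Iset n \<Longrightarrow> D (xg j) = w j \<cdot> xg j" "D (u * v) = D u * D v"
proof -
  interpret D: module_hom sc sc D by fact
  show one: "D 1 = 1"
    using mono[of "\<lambda>_. 0"] by (simp add: \<chi>_zero)
  show gen: "D (xg j) = w j \<cdot> xg j" if "j \<in> Iset n" for j
    using mono[of "(\<lambda>_. 0)(j := 1)"] \<chi>_Suc[of j "\<lambda>_. 0"] that by (simp add: mono_single \<chi>_zero)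
  have left: "D (xg j * v) = w j \<cdot> (xg j * D v)" if "j \<in> Iset n" for j v
    using D _ _ _ _ that
  proof (rule intertwine_left_mult[where s = sc and T = "\<lambda>j v. w j \<cdot> (xg j * v)"])
    show "module_hom sc sc (\<lambda>v. w j \<cdot> (xg j * v))" for j
      by (simp add: module_hom_iff module_axioms algebra_simps)
  next
    fix i j m assume "i \<in> Iset n" "j \<in> Iset n" "i < j" "j \<noteq> - i"
    then show "w j \<cdot> (xg j * (w i \<cdot> (xg i * m))) = q \<cdot> (w i \<cdot> (xg i * (w j \<cdot> (xg j * m))))"
      by (simp add: relation_assoc mult_ac)
  next
    fix i m assume i: "1 \<le> i" "i \<le> int n"
    then have "w i * w (- i) = 1" "w (- i) * w i = 1"
      using w[of i] w[of "- i"] by (auto simp: Iset_iff)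
    moreover have "w (- j) * w j = 1" if "j \<in> {i + 1..int n}" for j
      using that i w[of "- j"] by (auto simp: Iset_iff)
    ultimately show "w i \<cdot> (xg i * (w (- i) \<cdot> (xg (- i) * m))) =
       q\<^sup>2 \<cdot> (w (- i) \<cdot> (xg (- i) * (w i \<cdot> (xg i * m)))) +
       (q\<^sup>2 * lam) \<cdot> (\<Sum>j\<in>{i + 1..int n}. q ^ nat (j - (i + 1)) \<cdot> (w (- j) \<cdot> (xg (- j) * (w j \<cdot> (xg j * m)))))"
      by (simp add: relation_opposite_assoc[OF i] mult.assoc del: scale_left_diff_distrib right_diff_distrib)
  next
    fix a j assume *: "admissible n a" "j \<in> Iset n" "\<And>m. m \<in> Iset n \<Longrightarrow> m < j \<Longrightarrow> a m = 0"
    then show "D (mono xg n (a(j := Suc (a j)))) = w j \<cdot> (xg j * D (mono xg n a))"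
      by (simp add: mono \<chi>_Suc mono_prepend del: fun_upd_apply)
  qed
  show "D (u * v) = D u * D v"
    by (induction u rule: span_induct_generators)
      (simp_all add: one left gen D.add D.scale distrib_right mult.assoc)
qed

text \<open>Eigenvalues of \<open>kop i\<close> (for \<open>r = q\<close>) and \<open>kinv i\<close> (for \<open>r = inverse q\<close>) on normal monomials.\<close>

definition char :: "'k \<Rightarrow> int \<Rightarrow> (int \<Rightarrow> nat) \<Rightarrow> 'k" where
  "char r i a = (if i = 1 then (r ^ a (-1)) ^ 2 * (inverse r ^ a 1) ^ 2
     else r ^ a (- i) * inverse r ^ a (1 - i) * r ^ a (i - 1) * inverse r ^ a i)"

text \<open>The factor by which \<open>char\<close> changes when one \<open>x_j\<close> is added.
  The squares for i = 1 reflect the long root, where \<open>q_1 = q ^ 2\<close>.\<close>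

definition weight :: "'k \<Rightarrow> int \<Rightarrow> int \<Rightarrow> 'k" where
  "weight r i j = (if i = 1 then if j = -1 then r ^ 2 else if j = 1 then inverse r ^ 2 else 1
     else if j = - i \<or> j = i - 1 then r else if j = i \<or> j = 1 - i then inverse r else 1)"

lemma char_zero: "char r i (\<lambda>_. 0) = 1"
  by (simp add: char_def)

lemma char_Suc:
  assumes "1 \<le> i" "r \<noteq> 0"
  shows "char r i (a(j := Suc (a j))) = weight r i j * char r i a"
  using assms by (auto simp: char_def weight_def power2_eq_square)

lemma weight_uminus: "1 \<le> i \<Longrightarrow> r \<noteq> 0 \<Longrightarrow> weight r i j * weight r i (- j) = 1"
  by (auto simp: weight_def field_simps power2_eq_square)

lemma kop_hom: "module_hom sc sc (kop i)"
  and kinv_hom: "module_hom sc sc (kinv i)"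
  by (simp_all add: module_hom_iff module_axioms k_op_def kinv_op_def Let_def)

lemma kop_mono: "admissible n a \<Longrightarrow> kop i (mono xg n a) = char q (int i) a \<cdot> mono xg n a"
  and kinv_mono: "admissible n a \<Longrightarrow> kinv i (mono xg n a) = char (inverse q) (int i) a \<cdot> mono xg n a"
  by (simp_all add: k_op_def kinv_op_def Let_def char_def power2_eq_square mult_ac)

lemma kop_props:
  assumes "1 \<le> i"
  shows kop_one: "kop i 1 = 1" and kop_gen: "j \<in> Iset n \<Longrightarrow> kop i (xg j) = weight q (int i) j \<cdot> xg j"
    and kop_mult: "kop i (u * v) = kop i u * kop i v"
  using assms
  by (auto intro!: diagonal_hom_mult[OF kop_hom kop_mono char_zero char_Suc weight_uminus])

lemma kinv_props:
  assumes "1 \<le> i"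
  shows kinv_one: "kinv i 1 = 1" and kinv_mult: "kinv i (u * v) = kinv i u * kinv i v"
  using assms
  by (auto intro!: diagonal_hom_mult[OF kinv_hom kinv_mono char_zero char_Suc weight_uminus])

section \<open>The reversing anti-automorphism\<close>

lemma mono_append:
  assumes "j \<in> Iset n" "\<And>m. m \<in> Iset n \<Longrightarrow> j < m \<Longrightarrow> a m = 0"
  shows "mono xg n a * xg j = mono xg n (a(j := Suc (a j)))"
proof -
  have "(\<Sum>m | m \<in> Iset n \<and> j < m. a m) = 0"
    using assms by (intro sum.neutral) auto
  then show ?thesis
    using assms mono_insert_right[of j a] by simp
qed

text \<open>Reversing a normal monomial and negating its letters gives a normal monomial again, so
  \<open>\<theta>\<close> only permutes the basis.\<close>

definition \<theta> :: "'x \<Rightarrow> 'x" where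
  "\<theta> = linext emb xg n (\<lambda>a. mono xg n (a \<circ> uminus))"

lemma \<theta>_hom: "module_hom sc sc \<theta>"
  by (simp add: \<theta>_def linext_hom)

lemmas \<theta>_simps [simp] = module_hom.add[OF \<theta>_hom] module_hom.scale[OF \<theta>_hom]

lemma admissible_uminus [simp]: "admissible n (a \<circ> uminus) \<longleftrightarrow> admissible n a"
  by (auto simp: admissible_def o_def) (metis Iset_uminus minus_minus)

lemma \<theta>_mono [simp]: "admissible n a \<Longrightarrow> \<theta> (mono xg n a) = mono xg n (a \<circ> uminus)"
  by (simp add: \<theta>_def)

lemma \<theta>_gen [simp]: "j \<in> Iset n \<Longrightarrow> \<theta> (xg j) = xg (- j)"
proof -
  assume j: "j \<in> Iset n"
  have "((\<lambda>_. 0)(j := 1)) \<circ> uminus = (\<lambda>_. 0 :: nat)(- j := 1)"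
    by (auto simp: fun_eq_iff)
  then show ?thesis
    using \<theta>_mono[of "(\<lambda>_. 0)(j := 1)"] j by (simp add: mono_single del: \<theta>_mono)
qed

lemma \<theta>_one [simp]: "\<theta> 1 = 1"
  using \<theta>_mono[of "\<lambda>_. 0"] by (simp add: o_def del: \<theta>_mono)

lemma \<theta>_\<theta> [simp]: "\<theta> (\<theta> u) = u"
proof -
  have double_uminus: "uminus \<circ> uminus = (id :: int \<Rightarrow> int)"
    by (simp add: fun_eq_iff)
  have "(\<theta> \<circ> \<theta>) u = u"
    by (rule module_hom_eqI[OF module_hom_compose[OF \<theta>_hom \<theta>_hom] module_hom_ident])
      (simp add: comp_assoc double_uminus)
  then show ?thesis by simp
qed

text \<open>Reversal of the factors and negation of the letters each flip the order in a relation,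
  so right multiplications by \<open>x_{-j}\<close> satisfy the relations of left multiplications by
  \<open>x_j\<close>. Prepending the smallest letter turns into appending the largest.\<close>

lemma \<theta>_mult: "\<theta> (u * v) = \<theta> v * \<theta> u"
proof -
  have left: "\<theta> (xg j * v) = \<theta> v * xg (- j)" if "j \<in> Iset n" for j v
    using \<theta>_hom _ _ _ _ that
  proof (rule intertwine_left_mult[where s = sc and T = "\<lambda>j v. v * xg (- j)"])
    show "module_hom sc sc (\<lambda>v. v * xg (- j))" for j
      by (simp add: module_hom_iff module_axioms algebra_simps)
  next
    fix i j m assume "i \<in> Iset n" "j \<in> Iset n" "i < j" "j \<noteq> - i"
    then show "m * xg (- i) * xg (- j) = q \<cdot> (m * xg (- j) * xg (- i))"
      by (simp add: relation mult.assoc)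
  next
    fix i m assume i: "1 \<le> i" "i \<le> int n"
    show "m * xg (- (- i)) * xg (- i) = q\<^sup>2 \<cdot> (m * xg (- i) * xg (- (- i))) +
       (q\<^sup>2 * lam) \<cdot> (\<Sum>j\<in>{i + 1..int n}. q ^ nat (j - (i + 1)) \<cdot> (m * xg (- j) * xg (- (- j))))"
      by (simp add: mult.assoc relation_opposite[OF i] \<Omega>_def distrib_left sum_distrib_left)
  next
    fix a j assume *: "admissible n a" "j \<in> Iset n" "\<And>m. m \<in> Iset n \<Longrightarrow> m < j \<Longrightarrow> a m = 0"
    have "a(j := Suc (a j)) \<circ> uminus = (a \<circ> uminus)(- j := Suc ((a \<circ> uminus) (- j)))"
      by (auto simp: fun_eq_iff)
    then show "\<theta> (mono xg n (a(j := Suc (a j)))) = \<theta> (mono xg n a) * xg (- j)"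
      using * by (simp add: mono_append del: fun_upd_apply)
  qed
  show ?thesis
    by (induction u rule: span_induct_generators) (simp_all add: left distrib_left distrib_right mult.assoc)
qed

lemma \<theta>_operator:
  shows \<theta>_der: "\<theta> (der i u) = der (- i) (\<theta> u)"
    and \<theta>_\<mu>: "\<theta> (\<mu> i u) = \<mu> (- i) (\<theta> u)"
    and \<theta>_\<mu>': "\<theta> (\<mu>' i u) = \<mu>' (- i) (\<theta> u)"
    and \<theta>_\<tau>p: "\<theta> (\<tau>p i u) = \<tau>m i (\<theta> u)"
    and \<theta>_\<tau>m: "\<theta> (\<tau>m i u) = \<tau>p i (\<theta> u)"
proof -
  have commute: "\<theta> (S u) = T (\<theta> u)"
    if "module_hom sc sc S" "module_hom sc sc T"
      "\<And>a. admissible n a \<Longrightarrow> \<theta> (S (mono xg n a)) = T (\<theta> (mono xg n a))" for S T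
  proof -
    have "(\<theta> \<circ> S) u = (T \<circ> \<theta>) u"
      by (rule module_hom_eqI[OF module_hom_compose[OF that(1) \<theta>_hom] module_hom_compose[OF \<theta>_hom that(2)]])
        (simp only: o_apply that(3))
    then show ?thesis by simp
  qed
  have upd: "a(i := x) \<circ> uminus = (a \<circ> uminus)(- i := x)" for a :: "int \<Rightarrow> nat" and x
    by (auto simp: fun_eq_iff)
  have adm: "admissible n (a(i := a i - Suc 0))" if "admissible n a" for a
    using that by (auto simp: admissible_def)
  have sums: "(\<Sum>j\<in>{- int n..- i}. a (- j)) = (\<Sum>j\<in>{i..int n}. a j)"
    "(\<Sum>j\<in>{i..int n}. a (- j)) = (\<Sum>j\<in>{- int n..- i}. a j)" for a :: "int \<Rightarrow> nat"
    by (rule sum.reindex_bij_witness[of _ uminus uminus]; simp)+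
  show "\<theta> (der i u) = der (- i) (\<theta> u)"
    by (rule commute[OF der_hom der_hom]) (simp add: upd adm)
  show "\<theta> (\<mu> i u) = \<mu> (- i) (\<theta> u)" "\<theta> (\<mu>' i u) = \<mu>' (- i) (\<theta> u)"
    by (rule commute[OF \<mu>_hom \<mu>_hom] commute[OF \<mu>'_hom \<mu>'_hom]; simp)+
  show "\<theta> (\<tau>p i u) = \<tau>m i (\<theta> u)" "\<theta> (\<tau>m i u) = \<tau>p i (\<theta> u)"
    by (rule commute[OF \<tau>p_hom \<tau>m_hom] commute[OF \<tau>m_hom \<tau>p_hom]; simp add: sums)+
qed

text \<open>Conjugation by \<open>\<theta>\<close> exchanges left multiplication by
  \<open>x_j\<close> with right multiplication by \<open>x_{-j}\<close>, and \<open>\<tau>p\<close>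
  with \<open>\<tau>m\<close>. For i >= 2 corresponding summands of \<open>e_i\<close> and
  \<open>f_i\<close> have opposite signs, whence the minus.\<close>

lemma fop_\<theta>:
  assumes "1 \<le> i" "i \<le> n"
  shows "fop i u = (if i = 1 then \<theta> (eop i (\<theta> u)) else - \<theta> (eop i (\<theta> u)))"
proof -
  have "xg (1 - int i) = \<theta> (xg (int i - 1))" if "i \<noteq> 1"
    using \<theta>_gen[of "int i - 1"] assms that by (simp add: Iset_iff)
  moreover have "\<theta> (xg (- int i)) = xg (int i)" "\<theta> (xg (- 1)) = xg 1"
    using \<theta>_gen[of "- int i"] \<theta>_gen[of "- 1"] assms by (simp_all add: Iset_iff)
  ultimately show ?thesis
    by (simp add: f_op_def e_op_def Let_def \<theta>_operator \<theta>_mult module_hom.diff[OF \<theta>_hom] flip: sc_def)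
qed

lemma kinv_\<theta>: "kinv i u = \<theta> (kop i (\<theta> u))"
proof -
  have char: "char q (int i) (a \<circ> uminus) = char (inverse q) (int i) a" for a
    by (simp add: char_def)
  have "kinv i u = (\<theta> \<circ> (kop i \<circ> \<theta>)) u"
    by (rule module_hom_eqI[OF kinv_hom module_hom_compose[OF module_hom_compose[OF \<theta>_hom kop_hom] \<theta>_hom]])
      (simp add: kinv_mono kop_mono char, simp flip: \<theta>_mono)
  then show ?thesis by simp
qed

subsection \<open>Skew derivations and the short root operators\<close>

text \<open>In \<open>R1\<close> and \<open>R2\<close> each product \<open>x_j x_i\<close> is
  replaced by its Leibniz expansion, \<open>D(x_j) x_i\<close> times the weight of
  \<open>x_i\<close>, plus \<open>x_j D(x_i)\<close>. The assumption \<open>normal\<close> covers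
  the products that need no reordering.\<close>

lemma skew_leibniz:
  assumes D: "module_hom sc sc D" and D_one: "D 1 = 0"
    and \<kappa>: "module_hom sc sc \<kappa>" and \<kappa>_one: "\<kappa> 1 = 1" and \<kappa>_mult: "\<And>u v. \<kappa> (u * v) = \<kappa> u * \<kappa> v"
    and \<kappa>_gen: "\<And>j. j \<in> Iset n \<Longrightarrow> \<kappa> (xg j) = w j \<cdot> xg j"
    and w: "\<And>j. j \<in> Iset n \<Longrightarrow> w j * w (- j) = 1"
    and R1: "\<And>i j. \<lbrakk>i \<in> Iset n; j \<in> Iset n; i < j; j \<noteq> - i\<rbrakk> \<Longrightarrow>
      w i \<cdot> (D (xg j) * xg i) + xg j * D (xg i) = q \<cdot> (w j \<cdot> (D (xg i) * xg j) + xg i * D (xg j))"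
    and R2: "\<And>i. \<lbrakk>1 \<le> i; i \<le> int n\<rbrakk> \<Longrightarrow> w (- i) \<cdot> (D (xg i) * xg (- i)) + xg i * D (xg (- i)) =
      q ^ 2 \<cdot> (w i \<cdot> (D (xg (- i)) * xg i) + xg (- i) * D (xg i)) +
      (q ^ 2 * lam) \<cdot> (\<Sum>j\<in>{i + 1..int n}. q ^ nat (j - (i + 1)) \<cdot> (w j \<cdot> (D (xg (- j)) * xg j) + xg (- j) * D (xg j)))"
    and normal: "\<And>a j. \<lbrakk>admissible n a; j \<in> Iset n; \<And>m. m \<in> Iset n \<Longrightarrow> m < j \<Longrightarrow> a m = 0\<rbrakk> \<Longrightarrow>
      D (mono xg n (a(j := Suc (a j)))) = D (xg j) * \<kappa> (mono xg n a) + xg j * D (mono xg n a)"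
  shows "D (u * v) = D u * \<kappa> v + u * D v"
proof -
  interpret D: module_hom sc sc D by fact
  interpret \<kappa>: module_hom sc sc \<kappa> by fact
  define s :: "'k \<Rightarrow> 'x \<times> 'x \<Rightarrow> 'x \<times> 'x" where "s c p = (c \<cdot> fst p, c \<cdot> snd p)" for c p
  have s: "module s"
    by standard (auto simp: s_def algebra_simps)
  define T where "T j p = (w j \<cdot> (xg j * fst p), D (xg j) * fst p + xg j * snd p)" for j p
  define \<phi> where "\<phi> v = (\<kappa> v, D v)" for v
  have \<phi>: "module_hom sc s \<phi>"
    by (auto simp: module_hom_iff module_axioms s \<phi>_def s_def \<kappa>.add \<kappa>.scale D.add D.scale)
  have left: "\<phi> (xg j * v) = T j (\<phi> v)" if "j \<in> Iset n" for j v
    using \<phi> _ _ _ _ that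
  proof (rule intertwine_left_mult[where s = s and T = T])
    show "module_hom s s (T j)" for j
      by (auto simp: module_hom_iff s T_def s_def algebra_simps)
  next
    fix i j m assume *: "i \<in> Iset n" "j \<in> Iset n" "i < j" "j \<noteq> - i"
    have "snd (T j (T i m)) = (w i \<cdot> (D (xg j) * xg i) + xg j * D (xg i)) * fst m + xg j * (xg i * snd m)"
      by (simp add: T_def algebra_simps)
    then have "snd (T j (T i m)) = snd (s q (T i (T j m)))"
      unfolding R1[OF *] relation_assoc[OF *] by (simp add: T_def s_def algebra_simps)
    moreover have "fst (T j (T i m)) = fst (s q (T i (T j m)))"
      using * by (simp add: T_def s_def relation_assoc mult_ac)
    ultimately show "T j (T i m) = s q (T i (T j m))"
      by (rule prod_eqI[rotated])
  next
    fix i m assume i: "1 \<le> i" "i \<le> int n"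
    let ?rhs = "s (q\<^sup>2) (T (- i) (T i m)) +
       s (q\<^sup>2 * lam) (\<Sum>j\<in>{i + 1..int n}. s (q ^ nat (j - (i + 1))) (T (- j) (T j m)))"
    have ww: "w i * w (- i) = 1" "w (- i) * w i = 1"
      using w[of i] w[of "- i"] i by (auto simp: Iset_iff)
    have wj: "w (- j) * w j = 1" if "j \<in> {i + 1..int n}" for j
      using that i w[of "- j"] by (auto simp: Iset_iff)
    have "fst (T i (T (- i) m)) = fst ?rhs"
      using ww wj by (simp add: T_def s_def fst_sum relation_opposite_assoc[OF i] mult.assoc
          del: scale_left_diff_distrib right_diff_distrib)
    moreover have "snd (T i (T (- i) m)) = (w (- i) \<cdot> (D (xg i) * xg (- i)) + xg i * D (xg (- i))) * fst m + xg i * (xg (- i) * snd m)"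
      by (simp add: T_def algebra_simps)
    then have "snd (T i (T (- i) m)) = snd ?rhs"
      unfolding R2[OF i] relation_opposite_assoc[OF i]
      by (simp add: T_def s_def snd_sum distrib_right distrib_left scale_right_distrib sum_distrib_right
          sum.distrib mult.assoc add_ac)
    ultimately show "T i (T (- i) m) = ?rhs"
      by (rule prod_eqI)
  next
    fix a j assume *: "admissible n a" "j \<in> Iset n" "\<And>m. m \<in> Iset n \<Longrightarrow> m < j \<Longrightarrow> a m = 0"
    have "\<kappa> (mono xg n (a(j := Suc (a j)))) = w j \<cdot> (xg j * \<kappa> (mono xg n a))"
      using * by (simp flip: mono_prepend add: \<kappa>_mult \<kappa>_gen)
    then show "\<phi> (mono xg n (a(j := Suc (a j)))) = T j (\<phi> (mono xg n a))"
      unfolding \<phi>_def T_def fst_conv snd_conv by (simp only: normal[OF *])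
  qed
  then have left: "D (xg j * v) = D (xg j) * \<kappa> v + xg j * D v" if "j \<in> Iset n" for j v
    using that by (simp add: \<phi>_def T_def)
  show ?thesis
    by (induction u arbitrary: v rule: span_induct_generators)
      (simp_all add: D_one \<kappa>_one \<kappa>_mult left D.add D.scale algebra_simps)
qed

text \<open>This is the purpose of the tau factors in \<open>e_i\<close> and \<open>f_i\<close>:
  they cancel the power of q that a letter picks up on its way to its place.\<close>

lemma \<tau>m_insert_left:
  assumes "admissible n a" "1 \<le> i" "i \<le> int n"
  shows "\<tau>m (i + 1) (xg (- i) * mono xg n a) = mono xg n (a(- i := Suc (a (- i))))"
proof -
  have set: "{m. m \<in> Iset n \<and> m < - i} = {- int n..- (i + 1)}"
    using assms by (auto simp: Iset_iff)
  have "xg (- i) * mono xg n a = q ^ (\<Sum>m\<in>{- int n..- (i + 1)}. a m) \<cdot> mono xg n (a(- i := Suc (a (- i))))"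
    using mono_insert_left[of "- i" a] assms unfolding set by (auto simp: Iset_iff)
  moreover have "admissible n (a(- i := Suc (a (- i))))"
    using assms by (simp add: Iset_iff)
  moreover have "(\<Sum>m\<in>{- int n..- (i + 1)}. (a(- i := Suc (a (- i)))) m) = (\<Sum>m\<in>{- int n..- (i + 1)}. a m)"
    by (intro sum.cong) auto
  ultimately show ?thesis
    by (simp flip: power_mult_distrib del: fun_upd_apply)
qed

lemma \<tau>p_insert_right:
  assumes "admissible n a" "1 \<le> i" "i \<le> int n"
  shows "\<tau>p (i + 1) (mono xg n a * xg i) = mono xg n (a(i := Suc (a i)))"
proof -
  have set: "{m. m \<in> Iset n \<and> i < m} = {i + 1..int n}"
    using assms by (auto simp: Iset_iff)
  have "mono xg n a * xg i = q ^ (\<Sum>m\<in>{i + 1..int n}. a m) \<cdot> mono xg n (a(i := Suc (a i)))"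
    using mono_insert_right[of i a] assms unfolding set by (auto simp: Iset_iff)
  moreover have "admissible n (a(i := Suc (a i)))"
    using assms by (simp add: Iset_iff)
  moreover have "(\<Sum>m\<in>{i + 1..int n}. (a(i := Suc (a i))) m) = (\<Sum>m\<in>{i + 1..int n}. a m)"
    by (intro sum.cong) auto
  ultimately show ?thesis
    by (simp flip: power_mult_distrib del: fun_upd_apply)
qed

lemma eop_hom: "module_hom sc sc (eop i)"
  by (simp add: module_hom_iff module_axioms e_op_def Let_def algebra_simps flip: sc_def)

text \<open>After the cancellation by tau, each summand of \<open>e_i\<close> only shifts an
  exponent, from 1 - i to -i or from i to i - 1. Truncated subtraction is harmless since
  \<open>[0]_q = 0\<close>.\<close>

lemma eop_mono:
  assumes a: "admissible n a" and i: "2 \<le> i" "i \<le> n"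
  shows "eop i (mono xg n a) =
    (qint q (a (1 - int i)) * q ^ a (int i - 1) * inverse q ^ a (int i)) \<cdot>
      mono xg n (a(1 - int i := a (1 - int i) - 1, - int i := Suc (a (- int i)))) -
    qint q (a (int i)) \<cdot> mono xg n (a(int i := a (int i) - 1, int i - 1 := Suc (a (int i - 1))))"
proof -
  let ?b = "a(1 - int i := a (1 - int i) - 1)" and ?c = "a(int i := a (int i) - 1)"
  have adm: "admissible n ?b" "admissible n ?c"
    and adm': "admissible n (?b(- int i := Suc (?b (- int i))))"
    using a i by (auto simp: Iset_iff)
  have "\<tau>m (int i + 1) (xg (- int i) * mono xg n ?b) = mono xg n (?b(- int i := Suc (?b (- int i))))"
    using adm(1) i by (intro \<tau>m_insert_left) auto
  moreover have "\<tau>p (int i) (mono xg n ?c * xg (int i - 1)) = mono xg n (?c(int i - 1 := Suc (?c (int i - 1))))"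
    using \<tau>p_insert_right[of ?c "int i - 1"] adm(2) i by simp
  ultimately show ?thesis
    using i a adm' by (simp add: e_op_def Let_def mult_ac)
qed

lemma qint_1 [simp]: "qint q (Suc 0) = 1"
  by (simp add: qint_Suc)

lemma inverse_cancel: "inverse q * (q * c) = c" "q * (inverse q * c) = c"
  by (simp_all flip: mult.assoc)

lemma zero_upd_zero [simp]: "(\<lambda>_. 0)(i := 0) = (\<lambda>_. 0)"
  by auto

lemma \<Omega>_rec: "i \<le> int n \<Longrightarrow> \<Omega> i = xg (- i) * xg i + q \<cdot> \<Omega> (i + 1)"
proof -
  assume "i \<le> int n"
  then have "{i..int n} = insert i {i + 1..int n}"
    by auto
  moreover have "q ^ nat (j - i) = q * q ^ nat (j - (i + 1))" if "j \<in> {i + 1..int n}" for j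
    using that by (simp flip: power_Suc add: Suc_nat_eq_nat_zadd1)
  ultimately show ?thesis
    by (simp add: \<Omega>_def scale_sum_right)
qed

lemma eop_gen:
  assumes i: "2 \<le> i" "i \<le> n" and j: "j \<in> Iset n"
  shows "eop i (xg j) = (if j = 1 - int i then xg (- int i) else if j = int i then - xg (int i - 1) else 0)"
proof -
  have adm: "admissible n ((\<lambda>_. 0)(j := Suc 0))"
    using j by simp
  have "- int i \<in> Iset n" "int i - 1 \<in> Iset n"
    using i by (auto simp: Iset_iff)
  then show ?thesis
    using eop_mono[OF adm i] i unfolding mono_single[OF j]
    by (auto simp: mono_single)
qed

lemma eop_one:
  assumes "1 \<le> i" 
  shows "eop i 1 = 0"
  using assms der_mono[of "\<lambda>_. 0"] module_hom.zero[OF \<mu>_hom] module_hom.zero[OF \<mu>'_hom]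
    module_hom.zero[OF \<tau>p_hom] module_hom.zero[OF \<tau>m_hom]
  by (simp add: e_op_def Let_def)

lemma eop_mult_short:
  assumes i: "2 \<le> i" "i \<le> n"
  shows "eop i (u * v) = eop i u * kop i v + u * eop i v"
proof (rule skew_leibniz[where w = "weight q (int i)"])
  show "module_hom sc sc (eop i)" "module_hom sc sc (kop i)" "eop i 1 = 0" "kop i 1 = 1"
    "kop i (u * v) = kop i u * kop i v" "j \<in> Iset n \<Longrightarrow> kop i (xg j) = weight q (int i) j \<cdot> xg j"
    "weight q (int i) j * weight q (int i) (- j) = 1" for u v j
    using i by (simp_all add: eop_hom kop_hom eop_one kop_one kop_mult kop_gen weight_uminus)
next
  fix r j assume *: "r \<in> Iset n" "j \<in> Iset n" "r < j" "j \<noteq> - r"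
  have I: "- int i \<in> Iset n" "int i - 1 \<in> Iset n" "1 - int i \<in> Iset n" "int i \<in> Iset n"
    using i by (auto simp: Iset_iff)
  \<comment> \<open>Only \<open>x_{1-i}\<close> and \<open>x_i\<close> have a nonzero image under
    \<open>e_i\<close>. The first case, where both occur, is the only one that involves exchanges of
    opposite letters.\<close>
  consider "r = 1 - int i" "j = int i" | "r = 1 - int i" "j \<noteq> int i" | "r \<noteq> 1 - int i" "r \<noteq> int i" "j = int i" | "r = int i"
    | "r \<noteq> 1 - int i" "r \<noteq> int i" "j = 1 - int i" | "r \<noteq> 1 - int i" "r \<noteq> int i" "j \<noteq> 1 - int i" "j \<noteq> int i"
    by blast
  then show "weight q (int i) r \<cdot> (eop i (xg j) * xg r) + xg j * eop i (xg r) =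
             q \<cdot> (weight q (int i) j \<cdot> (eop i (xg r) * xg j) + xg r * eop i (xg j))"
  proof cases
    case 1
    have "xg (int i - 1) * xg (1 - int i) = q ^ 2 \<cdot> (xg (1 - int i) * xg (int i - 1)) + (q ^ 2 * lam) \<cdot> \<Omega> (int i)"
      using relation_opposite[of "int i - 1"] i by simp
    then have "inverse q \<cdot> (xg (int i - 1) * xg (1 - int i)) =
        q \<cdot> (xg (1 - int i) * xg (int i - 1)) + (q * lam) \<cdot> \<Omega> (int i)"
      by (simp add: scale_right_distrib power2_eq_square mult.assoc inverse_cancel)
    moreover have "\<Omega> (int i) = xg (- int i) * xg (int i) + q \<cdot> \<Omega> (int i + 1)"
      using i by (intro \<Omega>_rec) auto
    moreover have "xg (int i) * xg (- int i) = q ^ 2 \<cdot> (xg (- int i) * xg (int i)) + (q ^ 2 * lam) \<cdot> \<Omega> (int i + 1)"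
      using i by (intro relation_opposite) auto
    moreover have "eop i (xg r) = xg (- int i)" "eop i (xg j) = - xg (int i - 1)"
        "weight q (int i) r = inverse q" "weight q (int i) j = inverse q"
      using 1 i I by (auto simp: eop_gen weight_def)
    \<comment> \<open>The terms with \<open>\<Omega> (i + 1)\<close> cancel, and
      \<open>q ^ 2 - q * lam = 1\<close>.\<close>
    moreover from calculation have "xg (int i) * xg (- int i) - inverse q \<cdot> (xg (int i - 1) * xg (1 - int i)) =
        xg (- int i) * xg (int i) - q \<cdot> (xg (1 - int i) * xg (int i - 1))"
      by (simp only:) (simp add: algebra_simps power2_eq_square)
    ultimately show ?thesis
      unfolding 1 by (simp add: algebra_simps)
  next
    case 2
    then show ?thesis
      using i * I relation[of "- int i" j]
      by (auto simp: eop_gen weight_def)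
  next
    case 3
    then show ?thesis
      using i * I relation[of r "int i - 1"]
      by (auto simp: eop_gen weight_def)
  next
    case 4
    then show ?thesis
      using i * I relation[of "int i - 1" j]
      by (auto simp: eop_gen weight_def)
  next
    case 5
    then show ?thesis
      using i * I relation[of r "- int i"]
      by (auto simp: eop_gen weight_def)
  next
    case 6
    then show ?thesis
      using i * I by (auto simp: eop_gen weight_def)
  qed
next
  fix r assume r: "1 \<le> r" "r \<le> int n"
  show "weight q (int i) (- r) \<cdot> (eop i (xg r) * xg (- r)) + xg r * eop i (xg (- r)) =
         q\<^sup>2 \<cdot> (weight q (int i) r \<cdot> (eop i (xg (- r)) * xg r) + xg (- r) * eop i (xg r)) +
         (q\<^sup>2 * lam) \<cdot>
         (\<Sum>j\<in>{r + 1..int n}. q ^ nat (j - (r + 1)) \<cdot>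
              (weight q (int i) j \<cdot> (eop i (xg (- j)) * xg j) + xg (- j) * eop i (xg j)))"
  proof -
    have I: "- int i \<in> Iset n" "int i - 1 \<in> Iset n" "1 - int i \<in> Iset n" "int i \<in> Iset n"
      "r \<in> Iset n" "- r \<in> Iset n"
      using i r by (auto simp: Iset_iff)
    \<comment> \<open>All surviving terms of the relation for \<open>x_r\<close> and
      \<open>x_{-r}\<close> are multiples of z.\<close>
    define z where "z = xg (- int i) * xg (int i - 1)"
    have z: "xg (int i - 1) * xg (- int i) = q \<cdot> z"
      unfolding z_def using i I by (intro relation) auto
    have "(\<Sum>j\<in>{r + 1..int n}. q ^ nat (j - (r + 1)) \<cdot>
              (weight q (int i) j \<cdot> (eop i (xg (- j)) * xg j) + xg (- j) * eop i (xg j))) =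
        (\<Sum>j\<in>{r + 1..int n}. (if j = int i - 1 then (q * q ^ nat (int i - 1 - (r + 1))) \<cdot> z else 0) -
            (if j = int i then q ^ nat (int i - (r + 1)) \<cdot> z else 0))"
      using i r by (intro sum.cong refl) (auto simp: eop_gen weight_def z_def Iset_iff mult.commute[of q])
    also have "\<dots> = (if r + 1 \<le> int i - 1 then (q * q ^ nat (int i - 1 - (r + 1))) \<cdot> z else 0) -
            (if r + 1 \<le> int i then q ^ nat (int i - (r + 1)) \<cdot> z else 0)"
      using i r by (simp add: sum_subtractf)
    \<comment> \<open>The summands for i - 1 and i cancel when both lie in the range. For r = i - 1
      only the summand for i remains, with exponent 0.\<close>
    also have "\<dots> = (if r = int i - 1 then - z else 0)"
    proof (cases "r + 1 \<le> int i - 1")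
      case True
      then have "nat (int i - (r + 1)) = Suc (nat (int i - 1 - (r + 1)))"
        by simp
      then show ?thesis
        using True by (simp add: mult.commute)
    qed auto
    finally have sum: "(\<Sum>j\<in>{r + 1..int n}. q ^ nat (j - (r + 1)) \<cdot>
              (weight q (int i) j \<cdot> (eop i (xg (- j)) * xg j) + xg (- j) * eop i (xg j))) = (if r = int i - 1 then - z else 0)" .
    consider "r = int i - 1" | "r = int i" | "r \<noteq> int i - 1" "r \<noteq> int i"
      by blast
    then show ?thesis
    proof cases
      case 1
      have "eop i (xg r) = 0" "eop i (xg (- r)) = xg (- int i)" "weight q (int i) r = q"
        using i r I 1 by (auto simp: eop_gen weight_def)
      then show ?thesis
        unfolding sum unfolding 1 by (simp add: z algebra_simps power2_eq_square flip: z_def)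
    next
      case 2
      have "eop i (xg r) = - xg (int i - 1)" "eop i (xg (- r)) = 0" "weight q (int i) (- r) = q"
        using i r I 2 by (auto simp: eop_gen weight_def)
      then show ?thesis
        unfolding sum unfolding 2 by (simp add: z power2_eq_square flip: z_def)
    next
      case 3
      then have "eop i (xg r) = 0" "eop i (xg (- r)) = 0"
        using i r I by (auto simp: eop_gen)
      then show ?thesis
        unfolding sum using 3 by simp
    qed
  qed
next
  fix a j assume *: "admissible n a" "j \<in> Iset n" "\<And>m. m \<in> Iset n \<Longrightarrow> m < j \<Longrightarrow> a m = 0"
  have I: "- int i \<in> Iset n" "int i - 1 \<in> Iset n" "1 - int i \<in> Iset n" "int i \<in> Iset n"
    using i by (auto simp: Iset_iff)
  define A where "A a = mono xg n (a(1 - int i := a (1 - int i) - 1, - int i := Suc (a (- int i))))" for a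
  define B where "B a = mono xg n (a(int i := a (int i) - 1, int i - 1 := Suc (a (int i - 1))))" for a
  let ?a = "a(j := Suc (a j))"
  have eop: "eop i (mono xg n a) = (qint q (a (1 - int i)) * q ^ a (int i - 1) * inverse q ^ a (int i)) \<cdot> A a - qint q (a (int i)) \<cdot> B a"
    if "admissible n a" for a
    using eop_mono[OF that i] by (simp add: A_def B_def)
  have A: "xg j * A a = A ?a" if "a (1 - int i) \<noteq> 0" "j \<noteq> 1 - int i"
  proof -
    \<comment> \<open>If \<open>x_{1-i}\<close> occurs, then j is at most 1 - i, and being different
      from it, at most -i. So the new letter \<open>x_{-i}\<close> does not fall below
      \<open>x_j\<close> and the product stays normal.\<close>
    have "j \<le> - int i"
      using that *(3)[of "1 - int i"] I by linarith
    then show ?thesis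
      unfolding A_def using * I that by (subst mono_prepend) (auto simp: fun_upd_twist)
  qed
  have B: "xg j * B a = B ?a" if "a (int i) \<noteq> 0" "j \<noteq> int i"
  proof -
    have "j \<le> int i - 1"
      using that *(3)[of "int i"] I by linarith
    then show ?thesis
      unfolding B_def using * I that by (subst mono_prepend) (auto simp: fun_upd_twist)
  qed
  have char: "char q (int i) a = q ^ a (- int i) * inverse q ^ a (1 - int i) * q ^ a (int i - 1) * inverse q ^ a (int i)"
    using i by (simp add: char_def)
  consider "j = 1 - int i" | "j = int i" | "j \<noteq> 1 - int i" "j \<noteq> int i" by blast
  then show "eop i (mono xg n ?a) = eop i (xg j) * kop i (mono xg n a) + xg j * eop i (mono xg n a)"
  proof cases
    case 1
    define y where "y = xg (- int i) * mono xg n a"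
    \<comment> \<open>Here the new letter \<open>x_{-i}\<close> does lie below
      \<open>x_{1-i}\<close>; exchanging them yields the factor q of
      \<open>qint_Suc\<close>.\<close>
    have A': "xg (1 - int i) * A a = q \<cdot> y" if "a (1 - int i) \<noteq> 0"
    proof -
      have "A a = xg (- int i) * mono xg n (a(1 - int i := a (1 - int i) - 1))"
        unfolding A_def using * I 1 by (subst mono_prepend) auto
      also have "xg (1 - int i) * \<dots> = q \<cdot> (xg (- int i) * (xg (1 - int i) * mono xg n (a(1 - int i := a (1 - int i) - 1))))"
        using I i by (intro relation_assoc) auto
      also have "xg (1 - int i) * mono xg n (a(1 - int i := a (1 - int i) - 1)) = mono xg n a"
        using * I 1 that by (subst mono_prepend) auto
      finally show ?thesis by (simp add: y_def)
    qed
    have A_a: "A ?a = y"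
      unfolding A_def y_def using * I 1 by (subst mono_prepend) auto
    have zero: "a (- int i) = 0"
      using * I 1 by simp
    have "eop i (mono xg n ?a) = (qint q (Suc (a (1 - int i))) * q ^ a (int i - 1) * inverse q ^ a (int i)) \<cdot> y - qint q (a (int i)) \<cdot> B ?a"
      using eop[of ?a] * 1 i unfolding A_a by simp
    moreover have "xg j * eop i (mono xg n a) = (qint q (a (1 - int i)) * q ^ a (int i - 1) * inverse q ^ a (int i) * q) \<cdot> y - qint q (a (int i)) \<cdot> B ?a"
      unfolding eop[OF *(1)] right_diff_distrib sc_mult_right using A' B 1 i
      by (cases "a (1 - int i) = 0"; cases "a (int i) = 0") simp_all
    moreover have "eop i (xg j) * kop i (mono xg n a) = (inverse q ^ a (1 - int i) * q ^ a (int i - 1) * inverse q ^ a (int i)) \<cdot> y"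
      unfolding kop_mono[OF *(1)] char using * i 1 zero by (simp add: eop_gen y_def)
    ultimately show ?thesis
      by (simp add: qint_Suc scale_left_distrib distrib_left distrib_right mult_ac)
  next
    case 2
    define y where "y = xg (int i - 1) * mono xg n a"
    have zero: "a (- int i) = 0" "a (1 - int i) = 0" "a (int i - 1) = 0"
      using * I 2 i by simp_all
    have B': "xg (int i) * B a = q \<cdot> y" if "a (int i) \<noteq> 0"
    proof -
      have "B a = xg (int i - 1) * mono xg n (a(int i := a (int i) - 1))"
        unfolding B_def using * I 2 by (subst mono_prepend) auto
      also have "xg (int i) * \<dots> = q \<cdot> (xg (int i - 1) * (xg (int i) * mono xg n (a(int i := a (int i) - 1))))"
        using I i by (intro relation_assoc) auto
      also have "xg (int i) * mono xg n (a(int i := a (int i) - 1)) = mono xg n a"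
        using * I 2 that by (subst mono_prepend) auto
      finally show ?thesis by (simp add: y_def)
    qed
    have B_a: "B ?a = y"
      unfolding B_def y_def using * I 2 by (subst mono_prepend) auto
    have lhs: "eop i (mono xg n ?a) = - (qint q (Suc (a (int i))) \<cdot> y)"
      using eop[of ?a] * 2 i zero unfolding B_a by simp
    have rhs: "xg j * eop i (mono xg n a) = - ((q * qint q (a (int i))) \<cdot> y)"
      unfolding eop[OF *(1)] right_diff_distrib sc_mult_right using B' 2 zero
      by (cases "a (int i) = 0") (simp_all add: mult.commute)
    have "eop i (xg j) * kop i (mono xg n a) = - (inverse q ^ a (int i) \<cdot> y)"
      unfolding kop_mono[OF *(1)] char using * i 2 zero by (simp add: eop_gen y_def)
    then show ?thesis
      unfolding lhs rhs by (simp only: qint_Suc scale_left_distrib minus_add)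
  next
    case 3
    \<comment> \<open>Besides 1 - i and i, the coefficient of \<open>A a\<close> depends only on the
      exponent at i - 1. When \<open>x_{i-1}\<close> is prepended, normality makes that coefficient
      zero.\<close>
    have "a (1 - int i) = 0" if "j = int i - 1"
      using that *(3)[of "1 - int i"] I i by simp
    then show ?thesis
      using * I 3 A B i by (cases "a (1 - int i) = 0"; cases "a (int i) = 0") (auto simp: eop eop_gen algebra_simps)
  qed
qed

subsection \<open>The long root operator\<close>

text \<open>The closed form of \<open>eop 1 (xg 1 ^ c)\<close>. The terms in \<open>\<Omega> 2\<close> arise from moving \<open>xg (-1)\<close> to the
  left through the powers of \<open>xg 1\<close>.\<close>

definition e1_power :: "nat \<Rightarrow> 'x" where
  "e1_power c = (case c of 0 \<Rightarrow> 0 | Suc m \<Rightarrow> (inverse (qint q 2) * inverse q * qint q c) \<cdot>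
     ((inverse q ^ m + q ^ (m + 2)) \<cdot> (xg (-1) * xg 1 ^ m) + (q ^ 3 * lam * qint q m) \<cdot> (\<Omega> 2 * xg 1 ^ (m - 1))))"

lemma one_in_Iset: "1 \<in> Iset n" "-1 \<in> Iset n" 
  using n_ge_2 by (auto simp: Iset_iff)

text \<open>Moving \<open>x_1\<close> past \<open>x_{-j}\<close> gives q and past \<open>x_j\<close>
  gives its inverse.\<close>

lemma gen_1_\<Omega>: "xg 1 * \<Omega> 2 = \<Omega> 2 * xg 1"
proof -
  have "xg 1 * (xg (- j) * xg j) = xg (- j) * (xg j * xg 1)" if "j \<in> {2..int n}" for j
    using that relation[of "- j" 1] relation[of 1 j]
    by (simp add: Iset_iff flip: mult.assoc)
  then show ?thesis
    by (simp add: \<Omega>_def sum_distrib_left sum_distrib_right mult.assoc)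
qed

text \<open>Each exchange of \<open>x_1\<close> and \<open>x_{-1}\<close> leaves one
  \<open>\<Omega> 2\<close>, which commutes with \<open>x_1\<close>. Its coefficient is the
  geometric sum \<open>q ^ 2 * lam * (1 + q ^ 2 + ... + q ^ (2 * (c - 1)))\<close>.\<close>

lemma gen_1_power: "xg 1 ^ c * xg (-1) = q ^ (2 * c) \<cdot> (xg (-1) * xg 1 ^ c) +
    (q ^ (c + 1) * lam * qint q c) \<cdot> (\<Omega> 2 * xg 1 ^ (c - 1))"
proof (induction c)
  case (Suc c)
  \<comment> \<open>For c = 0 the exponent c - 1 is truncated, but then the term carries the factor
    \<open>[0]_q = 0\<close>.\<close>
  have "xg 1 * xg 1 ^ (c - 1) = xg 1 ^ c" if "c \<noteq> 0"
    using that by (cases c) auto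
  then have \<Omega>: "(q ^ (c + 1) * lam * qint q c) \<cdot> (xg 1 * (\<Omega> 2 * xg 1 ^ (c - 1))) = (q ^ (c + 1) * lam * qint q c) \<cdot> (\<Omega> 2 * xg 1 ^ c)"
    by (cases "c = 0") (simp_all add: gen_1_\<Omega> mult.assoc flip: mult.assoc[of "xg 1"])
  have "xg 1 ^ Suc c * xg (-1) = xg 1 * (xg 1 ^ c * xg (-1))"
    by (simp add: mult.assoc)
  also have "\<dots> = q ^ (2 * c) \<cdot> ((xg 1 * xg (-1)) * xg 1 ^ c) + (q ^ (c + 1) * lam * qint q c) \<cdot> (\<Omega> 2 * xg 1 ^ c)"
    by (simp only: Suc distrib_left sc_mult_right \<Omega>[unfolded mult.assoc] mult.assoc)
  also have "xg 1 * xg (-1) = q ^ 2 \<cdot> (xg (-1) * xg 1) + (q ^ 2 * lam) \<cdot> \<Omega> 2"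
    using relation_opposite[of 1] n_ge_2 by simp
  also have "q ^ (2 * c) \<cdot> ((q ^ 2 \<cdot> (xg (-1) * xg 1) + (q ^ 2 * lam) \<cdot> \<Omega> 2) * xg 1 ^ c) +
      (q ^ (c + 1) * lam * qint q c) \<cdot> (\<Omega> 2 * xg 1 ^ c) =
      (q ^ (2 * c) * q ^ 2) \<cdot> (xg (-1) * xg 1 ^ Suc c) +
      (q ^ (2 * c) * (q ^ 2 * lam) + q ^ (c + 1) * lam * qint q c) \<cdot> (\<Omega> 2 * xg 1 ^ c)"
    by (simp add: distrib_right scale_right_distrib scale_left_distrib mult.assoc
        del: scale_left_diff_distrib right_diff_distrib left_diff_distrib)
  also have "q ^ (2 * c) * (q ^ 2 * lam) + q ^ (c + 1) * lam * qint q c = q ^ (Suc c + 1) * lam * qint q (Suc c)"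
  proof -
    have "q ^ (2 * c) * (q ^ 2 * lam) + q ^ (c + 1) * (lam * qint q c) = q ^ (Suc c + 1) * (lam * qint q (Suc c))"
      unfolding lambda_qint by (simp add: field_simps power2_eq_square power_add power_mult)
    then show ?thesis by (simp only: mult.assoc)
  qed
  finally show ?case
    by (simp add: power_add power2_eq_square mult_ac)
qed simp

text \<open>Coefficient identities for \<open>e1_power_Suc\<close>, freed of q-integers by
  \<open>lambda_qint\<close>: r is q and p its inverse; z and y are \<open>q ^ c\<close> and
  \<open>inverse q ^ c\<close> in the first, \<open>q ^ m\<close> and \<open>inverse q ^ m\<close>
  with c = m + 1 in the second.\<close>

lemma e1_identities:
  fixes r p y z :: "'a::idom"
  assumes "r * p = 1"
  shows "(r - p) * (r * (r + p) * (y * y)) + (z - y) * (r * y + r * z) * r ^ 2 = (r * z - p * y) * (y + r ^ 2 * z)"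
    and "(y + r ^ 2 * z) * (r ^ 2 * (r - p)) + r ^ 3 * (z - y) = r ^ 3 * (r ^ 2 * z - p ^ 2 * y)"
  using assms by algebra+

text \<open>Clears the normalisation of \<open>e_1\<close>: h will be \<open>1 / (q [2]_q)\<close>
  and u its inverse.\<close>

lemma scale_identity:
  fixes h :: "'a::idom"
  assumes "h * u = 1" "u * y + x * v * w = x' * v'"
  shows "y + h * x * v * w = h * x' * v'"
  using assms by algebra

lemma cancel_identity:
  fixes l :: "'a::idom"
  assumes "l * u + (l * x) * v * w = (l * x') * v'" "l \<noteq> 0"
  shows "u + x * v * w = x' * v'"
  using assms by algebra

text \<open>The twisted Leibniz rule for \<open>x_1\<close> times \<open>x_1 ^ c\<close>, with
  \<open>x_{-1}\<close> as the image of \<open>x_1\<close> and \<open>inverse q ^ (2 * c)\<close> as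
  the eigenvalue of \<open>k_1\<close>.\<close>

lemma e1_power_Suc: "e1_power (Suc c) = inverse q ^ (2 * c) \<cdot> (xg (-1) * xg 1 ^ c) + xg 1 * e1_power c"
proof (cases c)
  case 0
  \<comment> \<open>The constant in \<open>e_1\<close> is chosen so that \<open>x_1\<close> is sent
    to \<open>x_{-1}\<close> with coefficient 1.\<close>
  have "inverse (qint q 2) * inverse q * (1 + q ^ 2) = 1"
  proof -
    have "qint q 2 = q + inverse q"
      by (simp add: numeral_2_eq_2 qint_Suc)
    moreover have "q * (q + inverse q) = 1 + q ^ 2"
      by (simp add: power2_eq_square algebra_simps)
    ultimately have "1 + q ^ 2 = q * qint q 2"
      by simp
    then show ?thesis
      by (simp add: mult.assoc inverse_cancel)
  qed
  with 0 show ?thesis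
    by (simp add: e1_power_def power2_eq_square)
next
  case (Suc m)
  define h where "h = inverse (qint q 2) * inverse q"
  have "xg 1 * xg 1 ^ (m - 1) = xg 1 ^ m" if "m \<noteq> 0"
    using that by (cases m) auto
  then have \<Omega>: "(q ^ 3 * lam * qint q m) \<cdot> (xg 1 * (\<Omega> 2 * xg 1 ^ (m - 1))) = (q ^ 3 * lam * qint q m) \<cdot> (\<Omega> 2 * xg 1 ^ m)"
    by (cases "m = 0") (simp_all add: gen_1_\<Omega> mult.assoc flip: mult.assoc[of "xg 1"])
  have r: "xg 1 * xg (-1) = q ^ 2 \<cdot> (xg (-1) * xg 1) + (q ^ 2 * lam) \<cdot> \<Omega> 2"
    using relation_opposite[of 1] n_ge_2 by simp
  have "xg 1 * e1_power c = (h * qint q c) \<cdot> ((inverse q ^ m + q ^ (m + 2)) \<cdot> ((xg 1 * xg (-1)) * xg 1 ^ m) + (q ^ 3 * lam * qint q m) \<cdot> (\<Omega> 2 * xg 1 ^ m))"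
    by (simp only: Suc e1_power_def nat.case sc_mult_right distrib_left \<Omega>[unfolded mult.assoc] h_def mult.assoc)
  also have "\<dots> = (h * qint q c * (inverse q ^ m + q ^ (m + 2)) * q ^ 2) \<cdot> (xg (-1) * xg 1 ^ c) +
     (h * qint q c * ((inverse q ^ m + q ^ (m + 2)) * (q ^ 2 * lam) + q ^ 3 * lam * qint q m)) \<cdot> (\<Omega> 2 * xg 1 ^ m)"
    unfolding r Suc power_Suc
    by (simp only: distrib_right scale_right_distrib scale_left_distrib mult.assoc scale_scale sc_mult_left distrib_left add.assoc)
  finally have rhs: "inverse q ^ (2 * c) \<cdot> (xg (-1) * xg 1 ^ c) + xg 1 * e1_power c =
     (inverse q ^ (2 * c) + h * qint q c * (inverse q ^ m + q ^ (m + 2)) * q ^ 2) \<cdot> (xg (-1) * xg 1 ^ c) +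
     (h * qint q c * ((inverse q ^ m + q ^ (m + 2)) * (q ^ 2 * lam) + q ^ 3 * lam * qint q m)) \<cdot> (\<Omega> 2 * xg 1 ^ m)"
    by (simp only: scale_left_distrib add.assoc)
  have lhs: "e1_power (Suc c) = (h * qint q (Suc c) * (inverse q ^ c + q ^ (c + 2))) \<cdot> (xg (-1) * xg 1 ^ c) +
     (h * qint q (Suc c) * (q ^ 3 * lam * qint q c)) \<cdot> (\<Omega> 2 * xg 1 ^ m)"
    by (simp only: e1_power_def nat.case h_def scale_right_distrib scale_scale Suc diff_Suc_1)
  have inv: "q * inverse q = 1"
    by simp
  \<comment> \<open>Comparison of the coefficients of \<open>x_{-1} x_1 ^ c\<close>.\<close>
  have 1: "inverse q ^ (2 * c) + h * qint q c * (inverse q ^ m + q ^ (m + 2)) * q ^ 2 = h * qint q (Suc c) * (inverse q ^ c + q ^ (c + 2))"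
  proof -
    have h: "h * (q * (q + inverse q)) = 1"
    proof -
      have "qint q 2 = q + inverse q"
        by (simp add: numeral_2_eq_2 qint_Suc)
      then show ?thesis
        using qint_2_nonzero by (simp add: h_def mult.assoc inverse_cancel)
    qed
    have powers: "inverse q ^ m = q * inverse q ^ c" "q ^ (m + 2) = q * q ^ c" "q ^ (c + 2) = q ^ 2 * q ^ c"
      "q ^ Suc c = q * q ^ c" "inverse q ^ Suc c = inverse q * inverse q ^ c"
      by (simp_all add: Suc inverse_cancel power2_eq_square)
    have double: "inverse q ^ (2 * c) = inverse q ^ c * inverse q ^ c"
      by (simp only: mult_2 power_add)
    have "lam * (q * (q + inverse q) * (inverse q ^ c * inverse q ^ c)) + (lam * qint q c) * (q * inverse q ^ c + q * q ^ c) * q ^ 2 =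
        (lam * qint q (Suc c)) * (inverse q ^ c + q ^ 2 * q ^ c)"
      unfolding lambda_qint powers by (rule e1_identities(1)[OF inv])
    then have "q * (q + inverse q) * (inverse q ^ c * inverse q ^ c) + qint q c * (q * inverse q ^ c + q * q ^ c) * q ^ 2 =
        qint q (Suc c) * (inverse q ^ c + q ^ 2 * q ^ c)"
      by (rule cancel_identity) simp
    then show ?thesis
      unfolding powers double by (rule scale_identity[OF h])
  qed
  \<comment> \<open>Comparison of the coefficients of \<open>\<Omega> 2\<close> times
    \<open>x_1 ^ m\<close>, without the common factor h and one q-integer on each side.\<close>
  have 2: "(inverse q ^ m + q ^ (m + 2)) * (q ^ 2 * lam) + q ^ 3 * lam * qint q m = q ^ 3 * lam * qint q (Suc c)"
  proof -
    have powers: "q ^ (m + 2) = q ^ 2 * q ^ m" "q ^ Suc c = q ^ 2 * q ^ m" "inverse q ^ Suc c = inverse q ^ 2 * inverse q ^ m"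
      by (simp_all add: Suc power2_eq_square mult_ac)
    have "(inverse q ^ m + q ^ (m + 2)) * (q ^ 2 * lam) + q ^ 3 * (lam * qint q m) = q ^ 3 * (lam * qint q (Suc c))"
      unfolding lambda_qint powers by (rule e1_identities(2)[OF inv])
    then show ?thesis
      by (simp only: mult.assoc)
  qed
  show ?thesis
    unfolding lhs rhs 1 2 by (simp add: mult_ac)
qed


section \<open>The value of \<open>e_1\<close> on normal monomials\<close>

abbreviation negs where "negs \<equiv> [- int n..-1]"
abbreviation poss where "poss \<equiv> [1..int n]"

lemma poss_Cons: "poss = 1 # [2..int n]"
  using n_ge_2 by (simp add: upto_rec1)

lemma mono_split: "mono xg n a = list_mono xg a negs * (xg 1 ^ a 1 * list_mono xg a [2..int n])"
  unfolding mono_list_mono idx_def list_mono_append poss_Cons list_mono_Cons ..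

lemma list_mono_negs_insert_right:
  assumes "j \<in> set negs"
  shows "list_mono xg a negs * xg j = q ^ (\<Sum>m | m \<in> set negs \<and> j < m. a m) \<cdot> list_mono xg (a(j := Suc (a j))) negs"
  using assms by (intro list_mono_insert_right) (auto simp: Iset_iff)

lemma list_mono_poss_insert_left:
  assumes "j \<in> set poss"
  shows "xg j * list_mono xg a poss = q ^ (\<Sum>m | m \<in> set poss \<and> m < j. a m) \<cdot> list_mono xg (a(j := Suc (a j))) poss"
  using assms by (intro list_mono_insert_left) (auto simp: Iset_iff)

text \<open>Inserting \<open>x_{-j} x_j\<close> raises exactly one exponent among 2..n and keeps
  that of \<open>x_1\<close>, so all summands of \<open>\<Omega> 2\<close> give eigenvectors with
  the same eigenvalue.\<close>

lemma \<Omega>_insert: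
  assumes b: "admissible n b"
  shows "\<mu>' 1 (\<tau>p 2 (list_mono xg b negs * \<Omega> 2 * list_mono xg b poss)) =
    (inverse q ^ b 1 * inverse q ^ Suc (\<Sum>m\<in>{2..int n}. b m)) \<cdot> (list_mono xg b negs * \<Omega> 2 * list_mono xg b poss)"
proof -
  interpret h: module_hom sc sc "\<mu>' 1 \<circ> \<tau>p 2"
    by (rule module_hom_compose[OF \<tau>p_hom \<mu>'_hom])
  let ?c = "inverse q ^ b 1 * inverse q ^ Suc (\<Sum>m\<in>{2..int n}. b m)"
  have summand: "(\<mu>' 1 \<circ> \<tau>p 2) (list_mono xg b negs * (xg (- j) * xg j) * list_mono xg b poss) = ?c \<cdot> (list_mono xg b negs * (xg (- j) * xg j) * list_mono xg b poss)"
    if j: "j \<in> {2..int n}" for j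
  proof -
    define b' where "b' = b(- j := Suc (b (- j)), j := Suc (b j))"
    have b': "admissible n b'"
      using b j by (simp add: b'_def Iset_iff)
    have "list_mono xg (b(- j := Suc (b (- j)))) negs = list_mono xg b' negs" "list_mono xg (b(j := Suc (b j))) poss = list_mono xg b' poss"
      using j by (auto simp: b'_def intro!: list_mono_cong)
    \<comment> \<open>These scalars depend on j, but an eigenvector may be rescaled freely.\<close>
    moreover obtain s t where "list_mono xg b negs * xg (- j) = s \<cdot> list_mono xg (b(- j := Suc (b (- j)))) negs"
      "xg j * list_mono xg b poss = t \<cdot> list_mono xg (b(j := Suc (b j))) poss"
      using list_mono_negs_insert_right[of "- j" b] list_mono_poss_insert_left[of j b] j by auto
    moreover have "list_mono xg b negs * (xg (- j) * xg j) * list_mono xg b poss = (list_mono xg b negs * xg (- j)) * (xg j * list_mono xg b poss)"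
      by (simp only: mult.assoc)
    ultimately have c: "list_mono xg b negs * (xg (- j) * xg j) * list_mono xg b poss = (s * t) \<cdot> mono xg n b'"
      by (simp add: mono_list_mono idx_def list_mono_append mult.commute)
    have "(\<Sum>m\<in>{2..int n}. b' m) = (\<Sum>m\<in>{2..int n}. b m + (if m = j then 1 else 0))"
      using j by (intro sum.cong) (auto simp: b'_def)
    then have "(\<Sum>m\<in>{2..int n}. b' m) = Suc (\<Sum>m\<in>{2..int n}. b m)"
      using j by (simp add: sum.distrib)
    moreover have "b' 1 = b 1"
      using j by (simp add: b'_def)
    ultimately show ?thesis
      unfolding c using b' by (simp add: mult_ac)
  qed
  have \<Omega>: "list_mono xg b negs * \<Omega> 2 * list_mono xg b poss = (\<Sum>j\<in>{2..int n}. q ^ nat (j - 2) \<cdot> (list_mono xg b negs * (xg (- j) * xg j) * list_mono xg b poss))"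
    by (simp add: \<Omega>_def sum_distrib_left sum_distrib_right mult.assoc)
  have "(\<mu>' 1 \<circ> \<tau>p 2) (list_mono xg b negs * \<Omega> 2 * list_mono xg b poss) = ?c \<cdot> (list_mono xg b negs * \<Omega> 2 * list_mono xg b poss)"
    unfolding \<Omega> h.sum h.scale scale_sum_right
    by (intro sum.cong refl) (simp add: summand mult.commute del: o_apply)
  then show ?thesis by simp
qed

text \<open>The letters other than \<open>x_1\<close> are carried along unchanged: the powers of q
  they cause are undone by the tau factors, which reduces \<open>e_1\<close> to powers of
  \<open>x_1\<close>.\<close>

lemma eop_1_mono:
  assumes a: "admissible n a"
  shows "eop 1 (mono xg n a) = list_mono xg a negs * (e1_power (a 1) * list_mono xg a [2..int n])"
proof (cases "a 1")
  case 0
  then show ?thesis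
    using a module_hom.zero[OF \<mu>'_hom] module_hom.zero[OF \<tau>p_hom] module_hom.zero[OF \<tau>m_hom]
    by (simp add: e_op_def Let_def e1_power_def)
next
  case (Suc c)
  define b where "b = a(1 := c)"
  define b' where "b' = b(-1 := Suc (b (-1)))"
  have b: "admissible n b" "admissible n b'" "b 1 = c" "b' 1 = c"
    using a one_in_Iset by (simp_all add: b_def b'_def)
  define P where "P = list_mono xg a negs"
  define Q where "Q = list_mono xg a [2..int n]"
  define S where "S = (\<Sum>m\<in>{2..int n}. a m)"
  have list_mono_b: "list_mono xg b negs = P" "list_mono xg b [2..int n] = Q"
    by (auto simp: b_def P_def Q_def intro!: list_mono_cong)
  have list_mono_b': "list_mono xg b' negs = P * xg (-1)" "list_mono xg b' [2..int n] = Q"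
  proof -
    have none: "{m. m \<in> set negs \<and> - 1 < m} = {}"
      by auto
    show "list_mono xg b' negs = P * xg (-1)"
      using list_mono_negs_insert_right[of "-1" b] n_ge_2 unfolding none list_mono_b b'_def by simp
  qed (auto simp: b'_def b_def Q_def intro!: list_mono_cong)
  have S: "(\<Sum>m\<in>{2..int n}. b m) = S" "(\<Sum>m\<in>{2..int n}. b' m) = S"
    unfolding S_def b'_def b_def by (rule sum.cong; simp)+
  \<comment> \<open>M is the normal monomial with exponents \<open>b'\<close>; N has
    \<open>\<Omega> 2\<close> in place of one product \<open>x_{-1} x_1\<close>.\<close>
  define M where "M = P * (xg (-1) * (xg 1 ^ c * Q))"
  define N where "N = P * (\<Omega> 2 * (xg 1 ^ (c - 1) * Q))"
  have M: "mono xg n b' = M"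
    by (simp add: mono_split list_mono_b' b M_def mult.assoc)
  have left: "\<mu>' 1 (\<tau>m 2 (xg (-1) * mono xg n b)) = inverse q ^ c \<cdot> M"
    using \<tau>m_insert_left[of b 1] b n_ge_2 by (simp flip: M b'_def)
  \<comment> \<open>The index list omits 1, so \<open>x_{-1}\<close> meets no \<open>x_1\<close> and
    only powers of q arise. The exponent at -1 is set to 0 so that the monomial is exactly
    Q.\<close>
  have QM: "Q * xg (-1) = q ^ S \<cdot> (xg (-1) * Q)"
  proof -
    let ?a = "a(-1 := 0)"
    have "sorted_wrt (<) (-1 # [2..int n])" "set (-1 # [2..int n]) \<subseteq> Iset n"
      using one_in_Iset by (auto simp: Iset_iff)
    then have "list_mono xg ?a (-1 # [2..int n]) * xg (-1) =
        q ^ (\<Sum>m | m \<in> set (-1 # [2..int n]) \<and> -1 < m. ?a m) \<cdot> list_mono xg (?a(-1 := Suc (?a (-1)))) (-1 # [2..int n])"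
      by (intro list_mono_insert_right) auto
    moreover have "{m. m \<in> set (-1 # [2..int n]) \<and> -1 < m} = {2..int n}"
      by auto
    moreover have "(\<Sum>m\<in>{2..int n}. ?a m) = S"
      unfolding S_def by (rule sum.cong) auto
    moreover have "list_mono xg ?a (-1 # [2..int n]) = Q" "list_mono xg (?a(-1 := Suc (?a (-1)))) (-1 # [2..int n]) = xg (-1) * Q"
      by (auto simp: Q_def intro!: list_mono_cong arg_cong2[of _ _ _ _ times])
    ultimately show ?thesis
      by (simp only:)
  qed
  have "mono xg n b * xg (-1) = q ^ S \<cdot> (P * (xg 1 ^ c * xg (-1)) * Q)"
    by (simp add: mono_split list_mono_b b QM mult.assoc)
  also have "\<dots> = (q ^ S * q ^ (2 * c)) \<cdot> M + (q ^ S * (q ^ (c + 1) * lam * qint q c)) \<cdot> N"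
    unfolding gen_1_power M_def N_def
    by (simp only: distrib_left distrib_right sc_mult_left sc_mult_right scale_right_distrib scale_scale mult.assoc)
  finally have *: "mono xg n b * xg (-1) = (q ^ S * q ^ (2 * c)) \<cdot> M + (q ^ S * (q ^ (c + 1) * lam * qint q c)) \<cdot> N" .
  \<comment> \<open>The coefficient is included because \<open>\<Omega>_insert\<close> is applied
    with exponent c - 1 at \<open>x_1\<close>; for c = 0 the coefficient contains
    \<open>[0]_q = 0\<close>.\<close>
  have N: "(q ^ S * (q ^ (c + 1) * lam * qint q c)) \<cdot> \<mu>' 1 (\<tau>p 2 N) = (q * lam * qint q c) \<cdot> N"
  proof (cases c)
    case (Suc m)
    define b'' where "b'' = a(1 := m)"
    have b'': "admissible n b''" "b'' 1 = m" "list_mono xg b'' negs = P" "list_mono xg b'' [2..int n] = Q" "(\<Sum>m\<in>{2..int n}. b'' m) = S"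
      using a one_in_Iset by (auto simp: b''_def P_def Q_def S_def intro!: list_mono_cong sum.cong)
    have "P * \<Omega> 2 * list_mono xg b'' poss = N"
      by (simp add: poss_Cons b'' N_def Suc mult.assoc)
    then have N: "\<mu>' 1 (\<tau>p 2 N) = (inverse q ^ m * inverse q ^ Suc S) \<cdot> N"
      using \<Omega>_insert[OF b''(1)] by (simp only: b'')
    have "q ^ S * (q ^ (c + 1) * lam * x) * (inverse q ^ m * inverse q ^ Suc S) =
        (q * inverse q) ^ S * (q * inverse q) ^ m * (q * inverse q) * (q * lam * x)" for x
      unfolding Suc power_mult_distrib power_add power_Suc by (simp only: mult_ac power_one_right power_Suc power_0)
    then show ?thesis
      unfolding N scale_scale by (simp only: right_inverse[OF q_nonzero] power_one mult_1_left)
  qed simp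
  have "q ^ S * q ^ (2 * c) * (inverse q ^ S * inverse q ^ c) = (q * inverse q) ^ S * (q * inverse q) ^ c * q ^ c"
    unfolding power_mult_distrib mult_2 power_add by (simp only: mult_ac)
  then have M': "(q ^ S * q ^ (2 * c)) \<cdot> \<mu>' 1 (\<tau>p 2 M) = q ^ c \<cdot> M"
    using b S by (simp flip: M)
  have right: "\<mu>' 1 (\<tau>p 2 (mono xg n b * xg (-1))) = q ^ c \<cdot> M + (q * lam * qint q c) \<cdot> N"
    unfolding * operator_add operator_scale N M' ..
  have "eop 1 (mono xg n a) = (inverse (qint q 2) * inverse q) \<cdot> \<mu>' 1 (\<tau>m 2 (xg (-1) * qint q (a 1) \<cdot> mono xg n b) +
      q ^ 2 \<cdot> \<tau>p 2 (qint q (a 1) \<cdot> mono xg n b * xg (-1)))"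
    using a by (simp add: e_op_def Let_def Suc b_def flip: sc_def)
  also have "\<dots> = (inverse (qint q 2) * inverse q * qint q (a 1)) \<cdot> (\<mu>' 1 (\<tau>m 2 (xg (-1) * mono xg n b)) +
      q ^ 2 \<cdot> \<mu>' 1 (\<tau>p 2 (mono xg n b * xg (-1))))"
    by (simp add: scale_right_distrib mult_ac)
  also have "\<dots> = (inverse (qint q 2) * inverse q * qint q (a 1)) \<cdot> ((inverse q ^ c + q ^ (c + 2)) \<cdot> M + (q ^ 3 * lam * qint q c) \<cdot> N)"
    unfolding left right
    by (simp add: scale_right_distrib scale_left_distrib power_add power2_eq_square power3_eq_cube mult_ac add_ac
        del: right_diff_distrib left_diff_distrib scale_left_diff_distrib)
  also have "\<dots> = P * (e1_power (a 1) * Q)"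
    unfolding M_def N_def e1_power_def Suc nat.case
    by (simp only: distrib_left distrib_right sc_mult_left sc_mult_right mult.assoc)
  finally show ?thesis
    by (simp only: P_def Q_def)
qed

section \<open>The twisted Leibniz rule for \<open>e_1\<close>\<close>

lemma eop_1_gen:
  assumes "j \<in> Iset n"
  shows "eop 1 (xg j) = (if j = 1 then xg (-1) else 0)"
proof -
  have "eop 1 (xg j) = list_mono xg ((\<lambda>_. 0)(j := Suc 0)) negs * (e1_power (if j = 1 then Suc 0 else 0) * list_mono xg ((\<lambda>_. 0)(j := Suc 0)) [2..int n])"
    using eop_1_mono[of "(\<lambda>_. 0)(j := Suc 0)"] assms by (simp add: mono_single)
  moreover have "list_mono xg (\<lambda>_. 0) L = 1" for L
    by (induction L) auto
  moreover have "e1_power (Suc 0) = xg (-1)"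
    using e1_power_Suc[of 0] by (simp add: e1_power_def)
  ultimately show ?thesis
    by (simp add: e1_power_def)
qed

lemma eop_mult_long: "eop 1 (u * v) = eop 1 u * kop 1 v + u * eop 1 v"
proof (rule skew_leibniz[where w = "weight q 1"])
  show "module_hom sc sc (eop 1)" "module_hom sc sc (kop 1)" "eop 1 1 = 0" "kop 1 1 = 1"
    "kop 1 (u * v) = kop 1 u * kop 1 v" "j \<in> Iset n \<Longrightarrow> kop 1 (xg j) = weight q 1 j \<cdot> xg j"
    "weight q 1 j * weight q 1 (- j) = 1" for u v j
    using kop_gen[of 1 j] by (simp_all add: eop_hom kop_hom eop_one kop_one kop_mult weight_uminus)
next
  fix r j assume *: "r \<in> Iset n" "j \<in> Iset n" "r < j" "j \<noteq> - r"
  moreover from this have "r \<noteq> 0"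
    by (simp add: Iset_iff)
  ultimately show "weight q 1 r \<cdot> (eop 1 (xg j) * xg r) + xg j * eop 1 (xg r) =
             q \<cdot> (weight q 1 j \<cdot> (eop 1 (xg r) * xg j) + xg r * eop 1 (xg j))"
    using relation[of r "-1"] relation[of "-1" j] one_in_Iset unfolding eop_1_gen[OF *(1)] eop_1_gen[OF *(2)]
    by (auto simp: weight_def)
next
  fix r assume r: "1 \<le> r" "r \<le> int n"
  have "(\<Sum>j\<in>{r + 1..int n}. q ^ nat (j - (r + 1)) \<cdot>
              (weight q 1 j \<cdot> (eop 1 (xg (- j)) * xg j) + xg (- j) * eop 1 (xg j))) = 0"
    using r by (intro sum.neutral ballI) (simp add: eop_1_gen[unfolded One_nat_def] Iset_iff)
  moreover have "eop 1 (xg (- r)) = 0" "eop 1 (xg r) = (if r = 1 then xg (-1) else 0)"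
    using r by (simp_all add: eop_1_gen[unfolded One_nat_def] Iset_iff)
  ultimately show "weight q 1 (- r) \<cdot> (eop 1 (xg r) * xg (- r)) + xg r * eop 1 (xg (- r)) =
         q\<^sup>2 \<cdot> (weight q 1 r \<cdot> (eop 1 (xg (- r)) * xg r) + xg (- r) * eop 1 (xg r)) +
         (q\<^sup>2 * lam) \<cdot>
         (\<Sum>j\<in>{r + 1..int n}. q ^ nat (j - (r + 1)) \<cdot>
              (weight q 1 j \<cdot> (eop 1 (xg (- j)) * xg j) + xg (- j) * eop 1 (xg j)))"
    by (simp only: sc_mult_left mult_zero_left mult_zero_right scale_zero_right) (simp add: weight_def)
next
  fix a j assume *: "admissible n a" "j \<in> Iset n" "\<And>m. m \<in> Iset n \<Longrightarrow> m < j \<Longrightarrow> a m = 0"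
  let ?a = "a(j := Suc (a j))"
  have adm: "admissible n ?a"
    using * by simp
  consider "j = 1" | "j \<in> set negs" | "2 \<le> j"
    using *(2) by (fastforce simp: Iset_iff)
  then show "eop 1 (mono xg n ?a) = eop 1 (xg j) * kop 1 (mono xg n a) + xg j * eop 1 (mono xg n a)"
  proof cases
    case 1
    have zero: "list_mono xg a negs = 1" if "\<And>m. m \<in> set negs \<Longrightarrow> a m = 0" for a
    proof -
      have "list_mono xg a negs = list_mono xg (\<lambda>_. 0) negs"
        using that by (intro list_mono_cong) auto
      then show ?thesis
        by (simp add: list_mono_def map_replicate_const)
    qed
    \<comment> \<open>With \<open>x_1\<close> as first letter of a normal product no negative letter
      occurs, so the claim reduces to \<open>e1_power_Suc\<close>.\<close>
    have a: "a m = 0" if "m \<in> set negs" for m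
      using that * 1 by (auto simp: Iset_iff)
    have "list_mono xg a negs = 1" "list_mono xg ?a negs = 1"
      using a 1 by (auto intro!: zero)
    moreover have "list_mono xg ?a [2..int n] = list_mono xg a [2..int n]"
      using 1 by (intro list_mono_upd_notin) simp
    moreover have "char q 1 a = inverse q ^ (2 * a 1)"
      using a[of "-1"] n_ge_2 by (simp add: char_def power_mult mult.commute)
    ultimately show ?thesis
      using 1 * kop_mono[OF *(1), of 1] unfolding eop_1_mono[OF *(1)] eop_1_mono[OF adm] unfolding mono_split
      by (simp add: e1_power_Suc eop_1_gen[unfolded One_nat_def] distrib_right mult.assoc)
  next
    case 2
    have "xg j * list_mono xg a negs = list_mono xg ?a negs"
    proof -
      have "(\<Sum>m | m \<in> set negs \<and> m < j. a m) = 0"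
        using * by (intro sum.neutral) (auto simp: Iset_iff)
      moreover have "set negs \<subseteq> Iset n"
        by (auto simp: Iset_iff)
      ultimately show ?thesis
        using list_mono_insert_left[of negs j a] 2 by auto
    qed
    moreover have "list_mono xg ?a [2..int n] = list_mono xg a [2..int n]"
      using 2 by (intro list_mono_upd_notin) auto
    moreover have "j \<noteq> 1"
      using 2 by auto
    ultimately show ?thesis
      using * unfolding eop_1_mono[OF *(1)] eop_1_mono[OF adm]
      by (simp add: eop_1_gen[unfolded One_nat_def] flip: mult.assoc[of "xg j"])
  next
    case 3
    \<comment> \<open>A normal product whose first letter is \<open>x_j\<close> with j >= 2 contains
      no \<open>x_1\<close>, so both sides vanish.\<close>
    then have "a 1 = 0" "?a 1 = 0" "j \<noteq> 1"
      using * one_in_Iset by auto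
    then show ?thesis
      using * unfolding eop_1_mono[OF *(1)] eop_1_mono[OF adm] by (simp add: eop_1_gen[unfolded One_nat_def] e1_power_def)
  qed
qed

subsection \<open>Words in the generators\<close>

lemma eop_mult:
  assumes "1 \<le> i" "i \<le> n"
  shows "eop i (u * v) = eop i u * kop i v + u * eop i v"
  using assms by (cases "i = 1") (simp_all only: eop_mult_long eop_mult_short)

lemma fop_hom: "module_hom sc sc (fop i)"
  by (simp add: module_hom_iff module_axioms f_op_def Let_def algebra_simps flip: sc_def)

text \<open>The rule for \<open>e_i\<close> conjugated by \<open>\<theta>\<close>: the factors
  change places and \<open>k_i\<close> becomes its inverse, which matches the coproduct of
  \<open>F i\<close>.\<close>

lemma fop_mult:
  assumes "1 \<le> i" "i \<le> n"
  shows "fop i (u * v) = fop i u * v + kinv i u * fop i v"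
  unfolding fop_\<theta>[OF assms] kinv_\<theta> \<theta>_mult eop_mult[OF assms] by (simp add: \<theta>_mult)

lemma fop_one: "1 \<le> i \<Longrightarrow> i \<le> n \<Longrightarrow> fop i 1 = 0"
  by (simp add: fop_\<theta> eop_one module_hom.zero[OF \<theta>_hom])

section \<open>Words, their coproducts and linear combinations of words\<close>

abbreviation Psi where "Psi \<equiv> Psi_gen emb xg n q"
abbreviation PsiW where "PsiW \<equiv> Psi_word emb xg n q"

lemma Psi_hom: "module_hom sc sc (Psi g)"
  by (cases g) (simp_all add: eop_hom fop_hom kop_hom kinv_hom)

lemma PsiW_Nil [simp]: "PsiW [] = id"
  and PsiW_Cons [simp]: "PsiW (g # w) = Psi g \<circ> PsiW w"
  by (simp_all add: Psi_word_def)

lemma PsiW_append: "PsiW (w @ w') = PsiW w \<circ> PsiW w'"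
  by (induction w) (simp_all add: comp_assoc)

lemma Psi_mult:
  assumes "1 \<le> gen_index g" "gen_index g \<le> n"
  shows "Psi g (u * v) = (\<Sum>(a, b)\<leftarrow>cop_gen g. PsiW a u * PsiW b v)"
  using assms by (cases g) (simp_all add: eop_mult fop_mult kop_mult kinv_mult)

lemma Psi_one:
  assumes "1 \<le> gen_index g" "gen_index g \<le> n"
  shows "Psi g 1 = eps_gen g \<cdot> 1"
  using assms by (cases g) (simp_all add: eop_one fop_one kop_one kinv_one)

lemma PsiW_one: "valid_word n w \<Longrightarrow> PsiW w 1 = eps_word w \<cdot> 1"
proof (induction w)
  case (Cons g w)
  then show ?case
    using module_hom.scale[OF Psi_hom, of g] by (simp add: valid_word_def eps_word_def Psi_one mult.commute)
qed (simp add: eps_word_def)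

lemma Psi_sum_list: "Psi g (\<Sum>x\<leftarrow>xs. h x) = (\<Sum>x\<leftarrow>xs. Psi g (h x))"
  by (induction xs) (simp_all add: module_hom.zero[OF Psi_hom] module_hom.add[OF Psi_hom])

lemma sum_list_concat_map: "(\<Sum>x\<leftarrow>concat (map ys xs). h x) = (\<Sum>y\<leftarrow>xs. \<Sum>x\<leftarrow>ys y. h x)"
  for h :: "_ \<Rightarrow> 'x"
  by (induction xs) simp_all

lemma sum_list_swap: "(\<Sum>x\<leftarrow>xs. \<Sum>y\<leftarrow>ys. h x y) = (\<Sum>y\<leftarrow>ys. \<Sum>x\<leftarrow>xs. h x y)"
  for h :: "_ \<Rightarrow> _ \<Rightarrow> 'x"
  by (induction xs) (simp_all add: sum_list_addf)

lemma PsiW_mult: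
  assumes "valid_word n w"
  shows "PsiW w (u * v) = (\<Sum>(a, b)\<leftarrow>cop_word w. PsiW a u * PsiW b v)"
  using assms
proof (induction w)
  case (Cons g w)
  have g: "1 \<le> gen_index g" "gen_index g \<le> n"
    and w: "valid_word n w"
    using Cons.prems by (auto simp: valid_word_def)
  have "PsiW (g # w) (u * v) = Psi g (\<Sum>(a', b')\<leftarrow>cop_word w. PsiW a' u * PsiW b' v)"
    by (simp add: Cons.IH[OF w])
  also have "\<dots> = (\<Sum>(a', b')\<leftarrow>cop_word w. \<Sum>(a, b)\<leftarrow>cop_gen g. PsiW (a @ a') u * PsiW (b @ b') v)"
    by (simp add: Psi_sum_list case_prod_unfold Psi_mult[OF g] PsiW_append)
  \<comment> \<open>Applying \<open>Psi g\<close> last yields the sum over \<open>cop_gen g\<close>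
    inside, while \<open>cop_word\<close> enumerates it outside.\<close>
  also have "\<dots> = (\<Sum>(a, b)\<leftarrow>cop_gen g. \<Sum>(a', b')\<leftarrow>cop_word w. PsiW (a @ a') u * PsiW (b @ b') v)"
    unfolding case_prod_unfold by (rule sum_list_swap)
  also have "\<dots> = (\<Sum>(a, b)\<leftarrow>cop_word (g # w). PsiW a u * PsiW b v)"
    by (simp add: case_prod_unfold sum_list_concat_map o_def)
  finally show ?case .
qed simp

lemma emb_zero [simp]: "emb 0 = 0"
  using emb_add[of 0 0] by simp

lemma act_one:
  assumes "\<forall>(c, w)\<in>set h. valid_word n w"
  shows "act emb xg n q h 1 = emb (eps_u h) * 1"
  using assms unfolding act_def eps_u_def
  by (induction h) (auto simp: PsiW_one emb_add emb_mult sc_def mult.assoc)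

lemma act_mult:
  assumes "\<forall>(c, w)\<in>set h. valid_word n w"
  shows "act emb xg n q h (u * v) = act_cop emb xg n q h u v"
  using assms unfolding act_def act_cop_def by (induction h) (auto simp: PsiW_mult)

end

theorem theorem3p7:
  fixes emb :: "'k::field_char_0 \<Rightarrow> 'x::ring_1"
    and xg :: "int \<Rightarrow> 'x" and n :: nat and q :: 'k
  assumes "n \<ge> 2"
    and "q \<noteq> 0"
    and "\<forall>m::nat. m > 0 \<longrightarrow> q ^ m \<noteq> 1"
    and "quantum_symplectic_space emb xg n q"
  shows "\<forall>h :: 'k uelt. (\<forall>(c, w)\<in>set h. valid_word n w) \<longrightarrow>
           act emb xg n q h 1 = emb (eps_u h) * 1 \<and>
           (\<forall>u v. act emb xg n q h (u * v) = act_cop emb xg n q h u v)"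
proof -
  interpret quantum_symplectic emb xg n q
    using assms by unfold_locales auto
  show ?thesis
    using act_one act_mult by blast
qed

end
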